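(* Let $\mathcal H$ be a Hilbert space, $\mathcal D\subset\mathcal H$ dense, $\{H_i\}_{i=1}^n$ symmetric operators densely defined on $\mathcal D$, $I\subset\mathbb R$ an interval, and $f_i:I\to\mathbb R$, $1\le i\le n$. Define $H(t)=\sum_{i=1}^n f_i(t)H_i$ with $\operatorname{dom}H(t)=\mathcal D$. Assume (i) $H(t)$ is self-adjoint for all $t\in I$; (ii) $f_i\in C^1(I)$ for every $i$; (iii) for every $i$ there exists $K>0$, independent of $t$, such that $\|H_i\Psi\|\le K(\|H(t)\Psi\|+\|\Psi\|)$ for all $\Psi\in\mathcal D$ and all $t\in I$. Then there exists a strongly differentiable unitary propagator $U(t,s)$, $s,t\in I$, such that for every $\Psi_s\in\mathcal D$, $\Psi(t)=U(t,s)\Psi_s$ satisfies \[\frac{d}{dt}\Psi(t)=-iH(t)\Psi(t),\qquad \Psi(s)=\Psi_s.\]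
   Context: A unitary propagator is a two-parameter family of unitary operators $U(s,t)$, $s,t\in\mathbb R$ (here in $I$), such that $U(r,s)U(s,t)=U(r,t)$, $U(t,t)=I$, and $U(s,t)$ is jointly strongly continuous in $s$ and $t$. *)

theory Defs
  imports "HOL-Analysis.Analysis"
begin

text \<open>A complex Hilbert space is modelled as a real Hilbert space
(type class real_inner + complete_space) together with a complex structure J,
which plays the role of multiplication by the imaginary unit i.\<close>

definition complex_structure :: "('a::real_inner \<Rightarrow> 'a) \<Rightarrow> bool" where
  "complex_structure J \<longleftrightarrow> linear J \<and> (\<forall>x. J (J x) = - x) \<and> (\<forall>x. norm (J x) = norm x)"

definition cscale :: "('a::real_inner \<Rightarrow> 'a) \<Rightarrow> complex \<Rightarrow> 'a \<Rightarrow> 'a" where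
  "cscale J c x = Re c *\<^sub>R x + Im c *\<^sub>R J x"

text \<open>Complex inner product, linear in the first, antilinear in the second argument (J acts as i).\<close>
definition cinner :: "('a::real_inner \<Rightarrow> 'a) \<Rightarrow> 'a \<Rightarrow> 'a \<Rightarrow> complex" where
  "cinner J x y = Complex (x \<bullet> y) (x \<bullet> J y)"

definition csubspace :: "('a::real_inner \<Rightarrow> 'a) \<Rightarrow> 'a set \<Rightarrow> bool" where
  "csubspace J S \<longleftrightarrow> subspace S \<and> (\<forall>x\<in>S. J x \<in> S)"

definition clinear_on :: "('a::real_inner \<Rightarrow> 'a) \<Rightarrow> 'a set \<Rightarrow> ('a \<Rightarrow> 'a) \<Rightarrow> bool" where
  "clinear_on J D A \<longleftrightarrow> (\<forall>x\<in>D. \<forall>y\<in>D. A (x + y) = A x + A y)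
     \<and> (\<forall>c. \<forall>x\<in>D. A (cscale J c x) = cscale J c (A x))"

definition densely_defined :: "('a::real_inner \<Rightarrow> 'a) \<Rightarrow> 'a set \<Rightarrow> ('a \<Rightarrow> 'a) \<Rightarrow> bool" where
  "densely_defined J D A \<longleftrightarrow> csubspace J D \<and> closure D = UNIV \<and> clinear_on J D A"

definition symmetric_op :: "('a::real_inner \<Rightarrow> 'a) \<Rightarrow> 'a set \<Rightarrow> ('a \<Rightarrow> 'a) \<Rightarrow> bool" where
  "symmetric_op J D A \<longleftrightarrow> densely_defined J D A
     \<and> (\<forall>x\<in>D. \<forall>y\<in>D. cinner J (A x) y = cinner J x (A y))"

definition adjoint_dom :: "('a::real_inner \<Rightarrow> 'a) \<Rightarrow> 'a set \<Rightarrow> ('a \<Rightarrow> 'a) \<Rightarrow> 'a set" where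
  "adjoint_dom J D A = {y. \<exists>z. \<forall>x\<in>D. cinner J (A x) y = cinner J x z}"

text \<open>Self-adjoint: symmetric and dom A* = dom A (then A* = A on D).\<close>
definition self_adjoint_op :: "('a::real_inner \<Rightarrow> 'a) \<Rightarrow> 'a set \<Rightarrow> ('a \<Rightarrow> 'a) \<Rightarrow> bool" where
  "self_adjoint_op J D A \<longleftrightarrow> symmetric_op J D A \<and> adjoint_dom J D A = D"

definition unitary_op :: "('a::real_inner \<Rightarrow> 'a) \<Rightarrow> ('a \<Rightarrow> 'a) \<Rightarrow> bool" where
  "unitary_op J U \<longleftrightarrow> clinear_on J UNIV U \<and> surj U \<and> (\<forall>x y. cinner J (U x) (U y) = cinner J x y)"

definition unitary_propagator ::
  "('a::real_inner \<Rightarrow> 'a) \<Rightarrow> real set \<Rightarrow> (real \<Rightarrow> real \<Rightarrow> 'a \<Rightarrow> 'a) \<Rightarrow> bool" where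
  "unitary_propagator J I U \<longleftrightarrow>
     (\<forall>t\<in>I. \<forall>s\<in>I. unitary_op J (U t s))
   \<and> (\<forall>r\<in>I. \<forall>s\<in>I. \<forall>t\<in>I. \<forall>x. U r s (U s t x) = U r t x)
   \<and> (\<forall>t\<in>I. \<forall>x. U t t x = x)
   \<and> (\<forall>x. continuous_on (I \<times> I) (\<lambda>(t, s). U t s x))"

end

(* With A(t) = -i H(t), which is skew-adjoint for the real inner product on the fixed domain D, the
   hypotheses (ii), (iii) give ||A(t)x - A(r)x|| <= C |t-r| (||A(r)x|| + ||x||) on compact intervals.
   Solve u' = A(t) u by the implicit Euler scheme u_{j+1} = (1 - h A(t_{j+1}))^{-1} u_j, with step
   h = 2^{-k}. The resolvents are contractions commuting with their generators, so ||A(t_j) u_j||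
   stays bounded (discrete Gronwall); skew-adjointness then bounds the squared distance between the
   schemes with steps h and h/2 by O(h). The limit u is Lipschitz, stays in D by the Riesz
   representation of y |-> <A(t)y, u(t)>, and is weakly differentiable. Weak solutions conserve the
   norm and hence are unique, so one may restart at any time t; since
   ||u(r) - u(t)|| <= |r-t| (||A(t)u(t)|| + o(1)), the weak derivative is a strong one. Solutions
   exist in both time directions, so by uniqueness they form isometries of D obeying the cocycle law,
   which extend to H by density. Joint strong continuity reduces to continuity in the first argument,
   because ||U(t,s)x - U(t,s')x|| = ||x - U(s,s')x||. *)

theory Submission
  imports Defs
begin

subsection \<open>Skew-adjoint operators and their resolvents\<close>

text \<open>Resolvents do not conserve the norm, so conservation is recovered only for the limit.
  The main obstacle is that the vectors \<open>A t\<close> applied to the iterates are bounded but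
  not shown to converge. The equation therefore passes to the limit only after \<open>A t\<close>
  has been moved onto a test vector in \<open>D\<close>; this forces the detour through weak
  solutions. Hypothesis (iii) bounds each \<open>Hs i\<close> by the graph norm of
  \<open>H r\<close>, uniformly in \<open>r\<close>. Lipschitz coefficients thus make the whole
  family Lipschitz in the graph norm of any of its members. Since \<open>I\<close> may be open or
  unbounded, such constants exist only on compact subintervals. The scheme is run on the whole line
  with one constant, compact intervals are reduced to it by freezing time at the endpoints, and the
  local solutions are glued. The analysis uses the real inner product alone; the complex structure
  returns at the end as an operator commuting with the generators.\<close>

text \<open>If \<open>z\<close> represents \<open>\<phi>\<close>, then \<open>Q y\<close> is the
  squared distance of \<open>y\<close> to \<open>z\<close> minus a constant. So \<open>z\<close> is
  found as the limit of a minimising sequence for \<open>Q\<close>. It lies only in the closure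
  because \<open>S\<close> may be incomplete, as the dense domain \<open>D\<close> is in the later
  application.\<close>

lemma riesz_on_subspace:
  fixes S :: "'a::{real_inner, complete_space} set" and \<phi> :: "'a \<Rightarrow> real"
  assumes S: "subspace S"
    and add: "\<And>x y. x \<in> S \<Longrightarrow> y \<in> S \<Longrightarrow> \<phi> (x + y) = \<phi> x + \<phi> y"
    and scale: "\<And>c x. x \<in> S \<Longrightarrow> \<phi> (c *\<^sub>R x) = c * \<phi> x"
    and bound: "\<And>x. x \<in> S \<Longrightarrow> \<bar>\<phi> x\<bar> \<le> C * norm x"
  shows "\<exists>z\<in>closure S. \<forall>y\<in>S. \<phi> y = y \<bullet> z"
proof -
  define Q where "Q y = y \<bullet> y - 2 * \<phi> y" for y
  have 0: "0 \<in> S" using S by (rule subspace_0)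
  have lower: "- C\<^sup>2 \<le> Q y" if "y \<in> S" for y
  proof -
    have "0 \<le> (norm y - C)\<^sup>2" by simp
    then have "- C\<^sup>2 \<le> (norm y)\<^sup>2 - 2 * (C * norm y)"
      by (simp add: power2_diff mult.commute)
    with bound[OF that] show ?thesis unfolding Q_def power2_norm_eq_inner by linarith
  qed
  have bdd: "bdd_below (Q ` S)" using lower by (intro bdd_belowI[of _ "- C\<^sup>2"]) auto
  define m where "m = Inf (Q ` S)"
  have m_le: "m \<le> Q y" if "y \<in> S" for y
    unfolding m_def using bdd that by (intro cInf_lower) auto
  have "\<exists>y\<in>S. Q y < m + inverse (real (Suc k))" for k
  proof -
    have "Inf (Q ` S) < m + inverse (real (Suc k))" unfolding m_def by simp
    then show ?thesis using cInf_lessD[of "Q ` S"] 0 by fastforce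
  qed
  then obtain y where yS: "\<And>k. y k \<in> S" and yQ: "\<And>k. Q (y k) < m + inverse (real (Suc k))"
    by metis
  \<comment> \<open>Parallelogram law for \<open>Q\<close>: the linear part cancels between the two
    points and their midpoint, and \<open>Q\<close> at the midpoint is at least
    \<open>m\<close>.\<close>
  have close: "(norm (y i - y j))\<^sup>2 \<le> 2 * (inverse (real (Suc i)) + inverse (real (Suc j)))" for i j
  proof -
    have sum_S: "y i + y j \<in> S" using S yS by (simp add: subspace_add)
    then have mid: "(1/2) *\<^sub>R (y i + y j) \<in> S" using S by (simp add: subspace_scale)
    have "Q ((1/2) *\<^sub>R (y i + y j)) = (1/4) * ((y i + y j) \<bullet> (y i + y j)) - (\<phi> (y i) + \<phi> (y j))"
      unfolding Q_def by (subst scale[OF sum_S], subst add[OF yS yS]) (simp add: algebra_simps)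
    then have "(norm (y i - y j))\<^sup>2 = 2 * Q (y i) + 2 * Q (y j) - 4 * Q ((1/2) *\<^sub>R (y i + y j))"
      by (simp add: power2_norm_eq_inner Q_def algebra_simps inner_commute)
    with yQ[of i] yQ[of j] m_le[OF mid] show ?thesis by argo
  qed
  have "Cauchy y"
  proof (rule metric_CauchyI)
    fix e :: real assume e: "e > 0"
    then obtain M where M: "inverse (real (Suc M)) < e\<^sup>2 / 4"
      using reals_Archimedean[of "e\<^sup>2 / 4"] by auto
    have "dist (y i) (y j) < e" if "i \<ge> M" "j \<ge> M" for i j
    proof -
      have "inverse (real (Suc i)) \<le> inverse (real (Suc M))" "inverse (real (Suc j)) \<le> inverse (real (Suc M))"
        using that by (auto intro!: le_imp_inverse_le)
      then have "(norm (y i - y j))\<^sup>2 < e\<^sup>2" using close[of i j] M by argo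
      then show ?thesis using e by (simp add: dist_norm power2_less_imp_less)
    qed
    then show "\<exists>M. \<forall>i\<ge>M. \<forall>j\<ge>M. dist (y i) (y j) < e" by blast
  qed
  then obtain z where z: "y \<longlonglongrightarrow> z" using Cauchy_convergent convergent_def by blast
  have zS: "z \<in> closure S" using z yS closure_sequential by blast
  have "\<phi> w = w \<bullet> z" if w: "w \<in> S" for w
  proof (cases "w = 0")
    case True
    then show ?thesis using scale[OF 0, of 0] by simp
  next
    case False
    have var: "0 \<le> 2 * t * (z \<bullet> w - \<phi> w) + t\<^sup>2 * (w \<bullet> w)" for t
    proof -
      have tw: "t *\<^sub>R w \<in> S" using S w by (simp add: subspace_scale)
      have nonneg: "0 \<le> 2 * t * (y k \<bullet> w - \<phi> w) + t\<^sup>2 * (w \<bullet> w) + inverse (real (Suc k))" for k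
      proof -
        have "m \<le> Q (y k + t *\<^sub>R w)" using S yS tw by (intro m_le subspace_add)
        also have "\<dots> = Q (y k) + 2 * t * (y k \<bullet> w - \<phi> w) + t\<^sup>2 * (w \<bullet> w)"
          by (simp add: Q_def add[OF yS tw] scale[OF w] algebra_simps inner_commute power2_eq_square)
        finally show ?thesis using yQ[of k] by linarith
      qed
      have "(\<lambda>k. 2 * t * (y k \<bullet> w - \<phi> w) + t\<^sup>2 * (w \<bullet> w) + inverse (real (Suc k)))
          \<longlonglongrightarrow> 2 * t * (z \<bullet> w - \<phi> w) + t\<^sup>2 * (w \<bullet> w) + 0"
        by (intro tendsto_intros z LIMSEQ_inverse_real_of_nat)
      from LIMSEQ_le_const[OF this] nonneg show ?thesis by auto
    qed
    \<comment> \<open>The quadratic in \<open>t\<close> from \<open>var\<close> is evaluated at its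
      minimiser \<open>- d / (w \<bullet> w)\<close>, which forces \<open>d\<close> to
      vanish.\<close>
    define d where "d = z \<bullet> w - \<phi> w"
    have ww: "w \<bullet> w > 0" using False by simp
    have "0 \<le> 2 * (- d / (w \<bullet> w)) * d + (- d / (w \<bullet> w))\<^sup>2 * (w \<bullet> w)"
      using var[of "- d / (w \<bullet> w)"] by (simp add: d_def)
    also have "\<dots> = - d\<^sup>2 / (w \<bullet> w)" using ww by (simp add: field_simps power2_eq_square)
    finally have "d\<^sup>2 \<le> 0" using ww by (simp add: field_simps)
    then show ?thesis by (simp add: d_def inner_commute)
  qed
  with zS show ?thesis by blast
qed

text \<open>The last clause says that the domain of the adjoint is not larger than \<open>D\<close>. Only the real inner
  product occurs: for a complex structure \<open>J\<close>, the operator \<open>- J \<circ> H\<close> is skew-adjoint in this sense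
  whenever \<open>H\<close> is self-adjoint.\<close>

definition skew_adjoint :: "'a::real_inner set \<Rightarrow> ('a \<Rightarrow> 'a) \<Rightarrow> bool" where
  "skew_adjoint D B \<longleftrightarrow> subspace D \<and> closure D = UNIV
     \<and> (\<forall>x\<in>D. \<forall>y\<in>D. B (x + y) = B x + B y)
     \<and> (\<forall>c. \<forall>x\<in>D. B (c *\<^sub>R x) = c *\<^sub>R B x)
     \<and> (\<forall>x\<in>D. \<forall>y\<in>D. B x \<bullet> y = - (x \<bullet> B y))
     \<and> (\<forall>y z. (\<forall>x\<in>D. B x \<bullet> y = x \<bullet> z) \<longrightarrow> y \<in> D)"

lemma orthogonal_dense_eq_0:
  fixes v :: "'a::real_inner"
  assumes "closure D = UNIV" "\<And>y. y \<in> D \<Longrightarrow> y \<bullet> v = 0"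
  shows "v = 0"
proof -
  obtain X where X: "\<And>n. X n \<in> D" "X \<longlonglongrightarrow> v"
    using assms(1) closure_sequential[of v D] by auto
  have "(\<lambda>n. X n \<bullet> v) \<longlonglongrightarrow> v \<bullet> v" by (intro tendsto_intros X)
  then have "v \<bullet> v = 0" using assms(2)[OF X(1)] LIMSEQ_unique tendsto_const by fastforce
  then show ?thesis by simp
qed

context
  fixes D :: "'a::{real_inner, complete_space} set" and B :: "'a \<Rightarrow> 'a"
  assumes B: "skew_adjoint D B"
begin

lemma skew_adjoint_subspace: "subspace D"
  and skew_adjoint_dense: "closure D = UNIV"
  and skew_adjoint_add: "x \<in> D \<Longrightarrow> y \<in> D \<Longrightarrow> B (x + y) = B x + B y"
  and skew_adjoint_scale: "x \<in> D \<Longrightarrow> B (c *\<^sub>R x) = c *\<^sub>R B x"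
  and skew_adjoint_skew: "x \<in> D \<Longrightarrow> y \<in> D \<Longrightarrow> B x \<bullet> y = - (x \<bullet> B y)"
  and skew_adjoint_domI: "(\<And>x. x \<in> D \<Longrightarrow> B x \<bullet> y = x \<bullet> z) \<Longrightarrow> y \<in> D"
  using B unfolding skew_adjoint_def by blast+

lemma skew_adjoint_diff: "x \<in> D \<Longrightarrow> y \<in> D \<Longrightarrow> B (x - y) = B x - B y"
  using skew_adjoint_add[of x "(-1) *\<^sub>R y"] skew_adjoint_scale[of y "-1"]
    subspace_scale[OF skew_adjoint_subspace, of y "-1"] by simp

lemma skew_adjoint_self [simp]: "x \<in> D \<Longrightarrow> B x \<bullet> x = 0"
  using skew_adjoint_skew[of x x] by (simp add: inner_commute)

text \<open>The domain clause in the form in which it is applied. It gives closedness of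
  \<open>B\<close> under limits tested against \<open>D\<close>, and regularity of vectors
  orthogonal to the range of a resolvent equation.\<close>

lemma skew_adjoint_domI_eq:
  assumes "\<And>x. x \<in> D \<Longrightarrow> B x \<bullet> y = - (x \<bullet> z)"
  shows "y \<in> D" "B y = z"
proof -
  show y: "y \<in> D" using skew_adjoint_domI[of y "- z"] assms by simp
  have "x \<bullet> (B y - z) = 0" if "x \<in> D" for x
    using skew_adjoint_skew[OF that y] assms[OF that] by (simp add: inner_diff_right)
  then show "B y = z" using orthogonal_dense_eq_0[OF skew_adjoint_dense] by fastforce
qed

text \<open>Pythagoras: \<open>B y\<close> is orthogonal to \<open>y\<close>, so the cross term
  vanishes for either sign of \<open>h\<close>.\<close>

lemma skew_adjoint_norm_resolvent:
  assumes "y \<in> D"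
  shows "norm y \<le> norm (y - h *\<^sub>R B y)"
proof (rule power2_le_imp_le)
  have "(norm (y - h *\<^sub>R B y))\<^sup>2 = (norm y)\<^sup>2 + (h * norm (B y))\<^sup>2"
    using skew_adjoint_self[OF assms]
    by (simp add: power2_norm_eq_inner power_mult_distrib algebra_simps inner_commute)
       (simp add: power2_eq_square)
  then show "(norm y)\<^sup>2 \<le> (norm (y - h *\<^sub>R B y))\<^sup>2" by simp
qed simp

text \<open>The lower norm bound turns convergence of images into convergence of preimages. The
  images then determine the limit of \<open>B (y n)\<close>, and moving \<open>B\<close> onto test
  vectors identifies it.\<close>

lemma skew_adjoint_resolvent_closed:
  assumes h: "h \<noteq> 0"
  shows "closed ((\<lambda>y. y - h *\<^sub>R B y) ` D)"
  unfolding closed_sequential_limits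
proof (intro allI impI, elim conjE)
  fix w x assume w: "\<forall>n. w n \<in> (\<lambda>y. y - h *\<^sub>R B y) ` D" and lim: "w \<longlonglongrightarrow> x"
  obtain y where y: "\<And>n. y n \<in> D" and wy: "\<And>n. w n = y n - h *\<^sub>R B (y n)"
    using w by (simp add: image_iff) metis
  have "dist (y i) (y j) \<le> dist (w i) (w j)" for i j
  proof -
    have "y i - y j \<in> D" using y subspace_diff[OF skew_adjoint_subspace] by blast
    from skew_adjoint_norm_resolvent[OF this, of h] show ?thesis
      by (simp add: dist_norm wy skew_adjoint_diff[OF y y] algebra_simps)
  qed
  moreover have "Cauchy w" using lim by (rule LIMSEQ_imp_Cauchy)
  ultimately have "Cauchy y" unfolding Cauchy_def by (meson order_le_less_trans)
  then obtain z where z: "y \<longlonglongrightarrow> z" using Cauchy_convergent convergent_def by blast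
  have By: "B (y n) = (1/h) *\<^sub>R (y n - w n)" for n using h by (simp add: wy)
  have Blim: "(\<lambda>n. B (y n)) \<longlonglongrightarrow> (1/h) *\<^sub>R (z - x)" unfolding By by (intro tendsto_intros z lim)
  have "B v \<bullet> z = - (v \<bullet> ((1/h) *\<^sub>R (z - x)))" if v: "v \<in> D" for v
  proof (rule LIMSEQ_unique)
    show "(\<lambda>n. B v \<bullet> y n) \<longlonglongrightarrow> B v \<bullet> z" by (intro tendsto_intros z)
    show "(\<lambda>n. B v \<bullet> y n) \<longlonglongrightarrow> - (v \<bullet> ((1/h) *\<^sub>R (z - x)))"
      unfolding skew_adjoint_skew[OF v y] by (intro tendsto_intros Blim)
  qed
  from skew_adjoint_domI_eq[OF this] have "z \<in> D" "x = z - h *\<^sub>R B z" using h by auto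
  then show "x \<in> (\<lambda>y. y - h *\<^sub>R B y) ` D" by blast
qed

text \<open>Riesz representation on the closed range provides the orthogonal projection
  \<open>z\<close> of \<open>x\<close>. The remainder \<open>v\<close> is orthogonal to the range,
  which says weakly that \<open>B v = - (1/h) *\<^sub>R v\<close>; hence \<open>v\<close> lies in
  \<open>D\<close> and skewness gives \<open>v = 0\<close>.\<close>

lemma skew_adjoint_resolvent_surj:
  assumes h: "h \<noteq> 0"
  shows "\<exists>y\<in>D. y - h *\<^sub>R B y = x"
proof -
  let ?S = "(\<lambda>y. y - h *\<^sub>R B y) ` D"
  have D: "subspace D" by (rule skew_adjoint_subspace)
  have S: "subspace ?S"
  proof (rule subspaceI)
    have "B 0 = 0" using skew_adjoint_scale[OF subspace_0[OF D], of 0] by simp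
    then have "0 = 0 - h *\<^sub>R B 0" by simp
    then show "0 \<in> ?S" using subspace_0[OF D] by (rule image_eqI)
  next
    fix v w assume "v \<in> ?S" "w \<in> ?S"
    then obtain a b where ab: "a \<in> D" "b \<in> D" "v = a - h *\<^sub>R B a" "w = b - h *\<^sub>R B b" by auto
    have "v + w = (a + b) - h *\<^sub>R B (a + b)"
      unfolding ab(3,4) skew_adjoint_add[OF ab(1,2)] by (simp add: algebra_simps)
    then show "v + w \<in> ?S" using subspace_add[OF D ab(1,2)] by blast
  next
    fix c v assume "v \<in> ?S"
    then obtain a where a: "a \<in> D" "v = a - h *\<^sub>R B a" by auto
    have "c *\<^sub>R v = c *\<^sub>R a - h *\<^sub>R B (c *\<^sub>R a)"
      unfolding a(2) skew_adjoint_scale[OF a(1)] by (simp add: algebra_simps)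
    then show "c *\<^sub>R v \<in> ?S" using subspace_scale[OF D a(1)] by blast
  qed
  have "\<exists>z\<in>closure ?S. \<forall>w\<in>?S. w \<bullet> x = w \<bullet> z"
    by (rule riesz_on_subspace[OF S, where C = "norm x"])
       (auto simp: inner_add_left Cauchy_Schwarz_ineq2 mult.commute)
  then obtain z where z: "z \<in> ?S" and orth: "\<And>w. w \<in> ?S \<Longrightarrow> w \<bullet> x = w \<bullet> z"
    using skew_adjoint_resolvent_closed[OF h] by (auto simp: closure_closed)
  define v where "v = x - z"
  have *: "(y - h *\<^sub>R B y) \<bullet> v = 0" if "y \<in> D" for y
    using orth[of "y - h *\<^sub>R B y"] that by (simp add: v_def inner_diff_right)
  have **: "B y \<bullet> v = - (y \<bullet> (- (1/h) *\<^sub>R v))" if "y \<in> D" for y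
    using *[OF that] h by (simp add: inner_diff_left field_simps)
  have vD: "v \<in> D" and "B v = - (1/h) *\<^sub>R v" using skew_adjoint_domI_eq[OF **] by blast+
  then have "v \<bullet> v = 0" using skew_adjoint_self[OF vD] h by simp
  then have "x \<in> ?S" using z by (simp add: v_def)
  then show ?thesis by blast
qed

end

subsection \<open>The implicit Euler scheme\<close>

text \<open>One constant for all real times: no domain restrictions on time have to be carried
  through the Euler estimates. \<open>t\<close> and \<open>r\<close> enter independently, so the
  graph norm may be taken at whichever time is already under control.\<close>

locale skew_adjoint_family =
  fixes D :: "'a::{real_inner, complete_space} set" and A :: "real \<Rightarrow> 'a \<Rightarrow> 'a" and C :: real
  assumes skew: "skew_adjoint D (A t)"
    and C_nonneg: "0 \<le> C"
    and A_lipschitz: "x \<in> D \<Longrightarrow> norm (A t x - A r x) \<le> C * \<bar>t - r\<bar> * (norm (A r x) + norm x)"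
begin

lemmas D_subspace = skew_adjoint_subspace[OF skew]

text \<open>The operator is taken at the end of the step, which makes each step a resolvent. For
  positive \<open>h\<close> the chosen \<open>y\<close> exists and is unique.\<close>

primrec euler :: "real \<Rightarrow> 'a \<Rightarrow> nat \<Rightarrow> 'a" where
  "euler h x 0 = x"
| "euler h x (Suc j) = (SOME y. y \<in> D \<and> y - h *\<^sub>R A (real (Suc j) * h) y = euler h x j)"

text \<open>An upper bound for \<open>norm (A t (u t))\<close> along solutions starting at \<open>x\<close>. It is sharp at
  \<open>t = 0\<close>, where it equals \<open>norm (A 0 x)\<close>; this makes the difference quotients converge
  strongly rather than only weakly.\<close>

definition growth :: "'a \<Rightarrow> real \<Rightarrow> real" where
  "growth x t = exp (C * t) * (norm (A 0 x) + norm x) - norm x"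

lemma growth_mono: "r \<le> t \<Longrightarrow> growth x r \<le> growth x t"
  unfolding growth_def by (simp add: C_nonneg mult_left_mono mult_right_mono)

lemma growth_nonneg: "0 \<le> t \<Longrightarrow> 0 \<le> growth x t"
proof -
  assume "0 \<le> t"
  moreover have "growth x 0 = norm (A 0 x)" by (simp add: growth_def)
  ultimately show ?thesis using growth_mono[of 0 t x] norm_ge_zero[of "A 0 x"] by linarith
qed

lemma euler_Suc:
  assumes "0 < h"
  shows euler_Suc_in_D: "euler h x (Suc j) \<in> D"
    and euler_Suc_eq: "euler h x (Suc j) - h *\<^sub>R A (real (Suc j) * h) (euler h x (Suc j)) = euler h x j"
proof -
  have "\<exists>y. y \<in> D \<and> y - h *\<^sub>R A (real (Suc j) * h) y = euler h x j"
    using skew_adjoint_resolvent_surj[OF skew] assms by (metis less_irrefl)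
  from someI_ex[OF this]
  show "euler h x (Suc j) \<in> D"
    "euler h x (Suc j) - h *\<^sub>R A (real (Suc j) * h) (euler h x (Suc j)) = euler h x j"
    by simp_all
qed

lemma euler_in_D: "0 < h \<Longrightarrow> x \<in> D \<Longrightarrow> euler h x j \<in> D"
  by (cases j) (simp_all add: euler_Suc_in_D del: euler.simps(2))

lemma norm_euler: "0 < h \<Longrightarrow> norm (euler h x j) \<le> norm x"
proof (induction j)
  case (Suc j)
  show ?case
    using skew_adjoint_norm_resolvent[OF skew euler_Suc_in_D[OF Suc.prems],
        of x j h "real (Suc j) * h"] Suc
    unfolding euler_Suc_eq[OF Suc.prems] by linarith
qed simp

text \<open>\<open>A t' y\<close> is a difference quotient of two iterates, so it lies in
  \<open>D\<close> and \<open>A t'\<close> may be applied to the step equation. The contraction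
  estimate for \<open>A t' y\<close> then bounds it by \<open>A t' e\<close>, and replacing
  \<open>t'\<close> by \<open>t\<close> there costs the Lipschitz bound over one step.\<close>

lemma norm_A_euler:
  assumes h: "0 < h" and x: "x \<in> D"
  shows "norm (A (real j * h) (euler h x j)) \<le> growth x (real j * h)"
proof (induction j)
  case 0
  then show ?case by (simp add: growth_def)
next
  case (Suc j)
  define t where "t = real j * h"
  define t' where "t' = real (Suc j) * h"
  define e where "e = euler h x j"
  define y where "y = euler h x (Suc j)"
  have tt: "t' - t = h" by (simp add: t_def t'_def algebra_simps)
  have eD: "e \<in> D" and yD: "y \<in> D"
    unfolding e_def y_def using euler_in_D[OF h x] by blast+
  have eq: "y - h *\<^sub>R A t' y = e" unfolding y_def e_def t'_def by (rule euler_Suc_eq[OF h])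
  then have By: "A t' y = (1/h) *\<^sub>R (y - e)" using h by auto
  have ByD: "A t' y \<in> D"
    unfolding By by (intro subspace_scale subspace_diff D_subspace yD eD)
  have "A t' e = A t' y - h *\<^sub>R A t' (A t' y)"
    unfolding eq[symmetric]
    by (subst skew_adjoint_diff[OF skew yD subspace_scale[OF D_subspace ByD]])
       (simp add: skew_adjoint_scale[OF skew ByD])
  then have "norm (A t' y) \<le> norm (A t' e)"
    using skew_adjoint_norm_resolvent[OF skew ByD, of h t'] by simp
  also have "\<dots> \<le> norm (A t e) + norm (A t' e - A t e)"
    by (metis norm_triangle_sub)
  also have "\<dots> \<le> norm (A t e) + C * h * (norm (A t e) + norm e)"
    using A_lipschitz[OF eD, of t' t] tt h by simp
  also have "\<dots> \<le> norm (A t e) + C * h * (norm (A t e) + norm x)"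
    using norm_euler[OF h, of x j] C_nonneg h by (simp add: e_def mult_left_mono)
  \<comment> \<open>Adding \<open>norm x\<close> to both sides makes the recursion purely
    multiplicative; this is where the shape of \<open>growth\<close> comes from.\<close>
  finally have "norm (A t' y) + norm x \<le> (1 + C * h) * (norm (A t e) + norm x)"
    by (simp add: algebra_simps)
  also have "\<dots> \<le> exp (C * h) * (norm (A t e) + norm x)"
    by (intro mult_right_mono exp_ge_add_one_self) simp
  also have "\<dots> \<le> exp (C * h) * (growth x t + norm x)"
    using Suc by (simp add: t_def e_def)
  also have "\<dots> = growth x t' + norm x"
    using tt by (simp add: growth_def exp_add[symmetric] mult.assoc[symmetric] distrib_left[symmetric] flip: tt)
  finally show ?case by (simp add: y_def t'_def del: euler.simps)
qed

lemma norm_A_euler_le: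
  assumes "0 < h" "x \<in> D" "real j * h \<le> T"
  shows "norm (A (real j * h) (euler h x j)) \<le> growth x T"
  using norm_A_euler[OF assms(1,2), of j] growth_mono[OF assms(3), of x] by linarith

lemma norm_euler_step:
  assumes "0 < h" "x \<in> D" "real (Suc j) * h \<le> T"
  shows "norm (euler h x (Suc j) - euler h x j) \<le> h * growth x T"
proof -
  have "euler h x (Suc j) - euler h x j = h *\<^sub>R A (real (Suc j) * h) (euler h x (Suc j))"
    using euler_Suc_eq[OF assms(1), of x j] by (simp add: algebra_simps)
  then show ?thesis using norm_A_euler_le[OF assms] assms(1) by (simp del: euler.simps)
qed

lemma norm_euler_diff:
  assumes h: "0 < h" "x \<in> D" and "i \<le> j" "real j * h \<le> T"
  shows "norm (euler h x j - euler h x i) \<le> (real j - real i) * h * growth x T"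
  using assms(3,4)
proof (induction j rule: dec_induct)
  case (step j)
  have "real j * h \<le> T" using step.prems h by (simp add: algebra_simps)
  then have "norm (euler h x j - euler h x i) \<le> (real j - real i) * h * growth x T"
    by (rule step.IH)
  moreover have "norm (euler h x (Suc j) - euler h x j) \<le> h * growth x T"
    by (rule norm_euler_step[OF h step.prems])
  moreover have "norm (euler h x (Suc j) - euler h x i)
      \<le> norm (euler h x (Suc j) - euler h x j) + norm (euler h x j - euler h x i)"
    using norm_triangle_ineq[of "euler h x (Suc j) - euler h x j" "euler h x j - euler h x i"]
    by (simp del: euler.simps)
  ultimately show ?case by (simp add: algebra_simps del: euler.simps)
qed simp

text \<open>The principal part of the difference of the two schemes drops out because \<open>B d \<bullet> d = 0\<close>. The
  remaining \<open>d \<bullet> B (v2 - v1)\<close> is of order \<open>h\<close> only after \<open>B\<close> has been moved to \<open>d\<close>, where the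
  a priori bound applies.\<close>

lemma euler_halving_step:
  assumes h: "0 < h" and x: "x \<in> D" and T: "real (Suc j) * h \<le> T"
  defines "G \<equiv> growth x T"
  shows "(norm (euler h x (Suc j) - euler (h/2) x (2 * Suc j)))\<^sup>2
    \<le> (norm (euler h x j - euler (h/2) x (2 * j)))\<^sup>2 + h\<^sup>2 * (G\<^sup>2 + C * norm x * (G + norm x))"
proof -
  have h2: "0 < h/2" using h by simp
  define B where "B = A (real (Suc j) * h)"
  define B' where "B' = A (real (Suc (2*j)) * (h/2))"
  define u where "u = euler h x (Suc j)"
  define v1 where "v1 = euler (h/2) x (Suc (2*j))"
  define v2 where "v2 = euler (h/2) x (Suc (Suc (2*j)))"
  define d where "d = u - v2"
  define d0 where "d0 = euler h x j - euler (h/2) x (2*j)"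
  have time2: "real (Suc (Suc (2*j))) * (h/2) = real (Suc j) * h" by (simp add: field_simps)
  have time1: "real (Suc (2*j)) * (h/2) = real (Suc j) * h - h/2" by (simp add: field_simps)
  have inD: "u \<in> D" "v1 \<in> D" "v2 \<in> D"
    unfolding u_def v1_def v2_def using euler_in_D[OF h x] euler_in_D[OF h2 x] by blast+
  have dD: "d \<in> D" and vD: "v2 - v1 \<in> D"
    unfolding d_def using inD by (auto intro: subspace_diff D_subspace)
  have u: "u - h *\<^sub>R B u = euler h x j" unfolding u_def B_def by (rule euler_Suc_eq[OF h])
  have v1: "v1 - (h/2) *\<^sub>R B' v1 = euler (h/2) x (2*j)"
    unfolding v1_def B'_def by (rule euler_Suc_eq[OF h2])
  have v2: "v2 - (h/2) *\<^sub>R B v2 = v1"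
    using euler_Suc_eq[OF h2, of x "Suc (2*j)"] unfolding v2_def v1_def B_def time2 .
  have skB: "skew_adjoint D B" unfolding B_def by (rule skew)
  have G0: "0 \<le> G"
    unfolding G_def using T h by (intro growth_nonneg order_trans[OF _ T]) simp
  have G: "norm (B u) \<le> G" "norm (B v2) \<le> G" "norm (B' v1) \<le> G"
  proof -
    show "norm (B u) \<le> G" unfolding B_def u_def G_def by (rule norm_A_euler_le[OF h x T])
    show "norm (B v2) \<le> G"
      using norm_A_euler_le[OF h2 x, of "Suc (Suc (2*j))" T] T unfolding time2 B_def v2_def G_def .
    show "norm (B' v1) \<le> G"
      unfolding B'_def v1_def G_def
      by (rule norm_A_euler_le[OF h2 x]) (use T h time1 in linarith)
  qed
  have v12: "norm (v2 - v1) \<le> h/2 * G"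
    unfolding v2_def v1_def G_def using T by (intro norm_euler_step[OF h2 x]) (simp only: time2)
  have nx: "norm u \<le> norm x" "norm v1 \<le> norm x" "norm v2 \<le> norm x"
    unfolding u_def v1_def v2_def using norm_euler[OF h] norm_euler[OF h2] by blast+
  \<comment> \<open>The second half step ends at the same time as the full step and shares its
    operator \<open>B\<close>. Only the first half step deviates, and \<open>q\<close> is the
    resulting defect.\<close>
  define q where "q = B v2 - B' v1"
  have d0: "d0 = d - (h *\<^sub>R B d + (h/2) *\<^sub>R q)"
  proof -
    have "h *\<^sub>R B v2 = (h/2) *\<^sub>R B v2 + (h/2) *\<^sub>R B v2"
      by (simp add: scaleR_add_left[symmetric])
    moreover have "d0 = (u - h *\<^sub>R B u) - (v1 - (h/2) *\<^sub>R B' v1)"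
      unfolding d0_def u v1 ..
    moreover have "v1 = v2 - (h/2) *\<^sub>R B v2" by (rule v2[symmetric])
    ultimately show ?thesis
      unfolding d_def q_def skew_adjoint_diff[OF skB inD(1) inD(3)] scaleR_diff_right by simp
  qed
  have "(norm d)\<^sup>2 \<le> (norm d0)\<^sup>2 + 2 * (d \<bullet> (d - d0))"
  proof -
    have "0 \<le> (norm (d - d0))\<^sup>2" by simp
    then show ?thesis by (simp add: power2_norm_eq_inner algebra_simps inner_commute)
  qed
  also have "d \<bullet> (d - d0) = h/2 * (d \<bullet> q)"
    using skew_adjoint_self[OF skB dD] by (simp add: d0 inner_add_right inner_commute)
  finally have main: "(norm d)\<^sup>2 \<le> (norm d0)\<^sup>2 + h * (d \<bullet> q)" by simp
  have q: "q = B (v2 - v1) + (B v1 - B' v1)"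
    by (simp add: q_def skew_adjoint_diff[OF skB inD(3) inD(2)])
  have "d \<bullet> B (v2 - v1) = - (B d \<bullet> (v2 - v1))"
    using skew_adjoint_skew[OF skB dD vD] by simp
  also have "\<dots> \<le> norm (B d) * norm (v2 - v1)"
    using norm_cauchy_schwarz[of "- B d" "v2 - v1"] by simp
  also have "\<dots> \<le> (2 * G) * (h/2 * G)"
  proof (intro mult_mono v12)
    have "norm (B d) \<le> norm (B u) + norm (B v2)"
      unfolding d_def skew_adjoint_diff[OF skB inD(1) inD(3)] by (rule norm_triangle_ineq4)
    then show "norm (B d) \<le> 2 * G" using G by linarith
  qed (use G0 in auto)
  finally have 1: "d \<bullet> B (v2 - v1) \<le> h * G\<^sup>2" by (simp add: power2_eq_square mult_ac)
  \<comment> \<open>The crude bound on \<open>norm d\<close> suffices, since the time difference of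
    the operators already contributes a factor \<open>h/2\<close>.\<close>
  have "d \<bullet> (B v1 - B' v1) \<le> norm d * norm (B v1 - B' v1)" by (rule norm_cauchy_schwarz)
  also have "\<dots> \<le> (2 * norm x) * (C * (h/2) * (G + norm x))"
  proof (intro mult_mono)
    show "norm d \<le> 2 * norm x"
      using nx norm_triangle_ineq4[of u v2] unfolding d_def by linarith
    have "norm (B v1 - B' v1) \<le> C * (h/2) * (norm (B' v1) + norm v1)"
      using A_lipschitz[OF inD(2), of "real (Suc j) * h" "real (Suc (2*j)) * (h/2)"] h
      unfolding B_def B'_def time1 by simp
    also have "\<dots> \<le> C * (h/2) * (G + norm x)"
      using C_nonneg h G nx by (intro mult_left_mono add_mono) auto
    finally show "norm (B v1 - B' v1) \<le> C * (h/2) * (G + norm x)" .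
  qed auto
  finally have 2: "d \<bullet> (B v1 - B' v1) \<le> h * (C * norm x * (G + norm x))" by (simp add: algebra_simps)
  have "d \<bullet> q \<le> h * (G\<^sup>2 + C * norm x * (G + norm x))"
    unfolding q inner_add_right using 1 2 by (simp add: algebra_simps)
  then have "h * (d \<bullet> q) \<le> h\<^sup>2 * (G\<^sup>2 + C * norm x * (G + norm x))"
    using h by (simp add: power2_eq_square mult.assoc)
  with main have "(norm d)\<^sup>2 \<le> (norm d0)\<^sup>2 + h\<^sup>2 * (G\<^sup>2 + C * norm x * (G + norm x))" by linarith
  then show ?thesis unfolding d_def d0_def u_def v2_def by (simp del: euler.simps)
qed

text \<open>The runs start at the same point and gain at most order \<open>h^2\<close> in squared
  distance per step. Over \<open>j\<close> steps with \<open>j * h\<close> bounded this adds up to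
  order \<open>h\<close>, so the runs themselves differ by order \<open>sqrt h\<close>.\<close>

lemma euler_halving:
  assumes h: "0 < h" and x: "x \<in> D" and T: "real j * h \<le> T"
  defines "G \<equiv> growth x T"
  shows "(norm (euler h x j - euler (h/2) x (2 * j)))\<^sup>2
    \<le> real j * h\<^sup>2 * (G\<^sup>2 + C * norm x * (G + norm x))"
  using T
proof (induction j)
  case (Suc j)
  have "real j * h \<le> T" using Suc.prems h by (simp add: algebra_simps)
  from Suc.IH[OF this] euler_halving_step[OF h x Suc.prems] show ?case
    unfolding G_def by (simp add: algebra_simps del: euler.simps mult_Suc_right)
qed simp

end

subsection \<open>The limit of the Euler scheme\<close>

context skew_adjoint_family
begin

definition grid_index :: "nat \<Rightarrow> real \<Rightarrow> nat" where
  "grid_index k t = nat \<lfloor>t * 2 ^ k\<rfloor>"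

text \<open>Piecewise constant rather than interpolated: every value is an Euler iterate and
  inherits the bounds directly. The price is an error of one grid step in the Lipschitz
  estimate.\<close>

definition euler_path :: "nat \<Rightarrow> 'a \<Rightarrow> real \<Rightarrow> 'a" where
  "euler_path k x t = euler ((1/2) ^ k) x (grid_index k t)"

definition forward_solution :: "'a \<Rightarrow> real \<Rightarrow> 'a" where
  "forward_solution x t = lim (\<lambda>k. euler_path k x t)"

lemma grid_index_bounds:
  assumes "0 \<le> t"
  shows "real (grid_index k t) * (1/2) ^ k \<le> t"
    and "t < real (grid_index k t) * (1/2) ^ k + (1/2) ^ k"
proof -
  have "0 \<le> t * 2 ^ k" using assms by simp
  then have eq: "real (grid_index k t) = real_of_int \<lfloor>t * 2 ^ k\<rfloor>"
    unfolding grid_index_def by simp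
  have "real (grid_index k t) \<le> t * 2 ^ k" unfolding eq by (rule of_int_floor_le)
  then show "real (grid_index k t) * (1/2) ^ k \<le> t" by (simp add: field_simps power_divide)
  have "t * 2 ^ k < real (grid_index k t) + 1" unfolding eq by linarith
  then show "t < real (grid_index k t) * (1/2) ^ k + (1/2) ^ k" by (simp add: field_simps power_divide)
qed

lemma grid_index_mono: "r \<le> t \<Longrightarrow> grid_index k r \<le> grid_index k t"
  unfolding grid_index_def by (intro nat_mono floor_mono mult_right_mono) auto

lemma grid_index_Suc:
  assumes "0 \<le> t"
  shows "grid_index (Suc k) t = 2 * grid_index k t \<or> grid_index (Suc k) t = Suc (2 * grid_index k t)"
proof -
  let ?i = "grid_index k t" and ?j = "grid_index (Suc k) t"
  have h: "(0::real) < (1/2) ^ k" by simp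
  have "real (2 * ?i) * (1/2) ^ k < real (?j + 1) * (1/2) ^ k"
    using grid_index_bounds(1)[OF assms, of k] grid_index_bounds(2)[OF assms, of "Suc k"]
    by (simp add: field_simps)
  moreover have "real ?j * (1/2) ^ k < real (2 * ?i + 2) * (1/2) ^ k"
    using grid_index_bounds(2)[OF assms, of k] grid_index_bounds(1)[OF assms, of "Suc k"]
    by (simp add: field_simps)
  ultimately have "real (2 * ?i) < real (?j + 1)" "real ?j < real (2 * ?i + 2)"
    using h by (simp_all only: mult_less_cancel_right_pos)
  then show ?thesis by linarith
qed

lemma euler_path_0 [simp]: "euler_path k x 0 = x"
  by (simp add: euler_path_def grid_index_def)

lemma euler_path_in_D: "x \<in> D \<Longrightarrow> euler_path k x t \<in> D"
  unfolding euler_path_def by (rule euler_in_D) simp_all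

lemma norm_euler_path: "norm (euler_path k x t) \<le> norm x"
  unfolding euler_path_def by (rule norm_euler) simp

lemma euler_path_lipschitz:
  assumes x: "x \<in> D" and rt: "0 \<le> r" "r \<le> t" "t \<le> T"
  shows "norm (euler_path k x t - euler_path k x r) \<le> (t - r + (1/2) ^ k) * growth x T"
proof -
  have t: "0 \<le> t" using rt by simp
  let ?i = "grid_index k r" and ?j = "grid_index k t" and ?h = "(1/2::real) ^ k"
  have "norm (euler_path k x t - euler_path k x r) \<le> (real ?j - real ?i) * ?h * growth x T"
    unfolding euler_path_def
    using x grid_index_mono[OF rt(2)] grid_index_bounds(1)[OF t, of k] rt by (intro norm_euler_diff) auto
  also have "\<dots> \<le> (t - r + ?h) * growth x T"
    using grid_index_bounds[OF t, of k] grid_index_bounds[OF rt(1), of k] rt growth_nonneg[of T x]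
    by (intro mult_right_mono) (simp_all add: algebra_simps)
  finally show ?thesis .
qed

text \<open>Two errors add up: the halving error of order \<open>sqrt h\<close> at the common grid
  point, and at most one extra half step that the finer path has already made. Both decay at least
  like \<open>sqrt (1/2) ^ k\<close>, hence summably in \<open>k\<close>.\<close>

lemma euler_path_Suc_diff:
  assumes x: "x \<in> D" and t: "0 \<le> t"
  defines "G \<equiv> growth x t"
  shows "norm (euler_path k x t - euler_path (Suc k) x t)
    \<le> (sqrt (t * (G\<^sup>2 + C * norm x * (G + norm x))) + G) * sqrt (1/2) ^ k"
proof -
  define M where "M = G\<^sup>2 + C * norm x * (G + norm x)"
  define h :: real where "h = (1/2) ^ k"
  have h: "0 < h" by (simp add: h_def)
  have hs: "h = (sqrt (1/2) ^ k)\<^sup>2"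
  proof -
    have "(sqrt (1/2) ^ k)\<^sup>2 = ((sqrt (1/2))\<^sup>2) ^ k"
      by (simp only: power_mult[symmetric] mult.commute[of k])
    then show ?thesis by (simp add: h_def)
  qed
  let ?i = "grid_index k t"
  have it: "real ?i * h \<le> t" unfolding h_def by (rule grid_index_bounds(1)[OF t])
  have G0: "0 \<le> G" unfolding G_def by (rule growth_nonneg[OF t])
  have M0: "0 \<le> M" unfolding M_def using G0 C_nonneg by simp
  have "(norm (euler h x ?i - euler (h/2) x (2 * ?i)))\<^sup>2 \<le> real ?i * h\<^sup>2 * M"
    unfolding M_def G_def by (rule euler_halving[OF h x it])
  also have "\<dots> = (real ?i * h) * (h * M)" by (simp add: power2_eq_square)
  also have "\<dots> \<le> t * (h * M)" using it h M0 by (intro mult_right_mono) auto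
  also have "\<dots> = (sqrt (t * M) * sqrt (1/2) ^ k)\<^sup>2"
    using t M0 by (simp add: power_mult_distrib hs)
  finally have 1: "norm (euler h x ?i - euler (h/2) x (2 * ?i)) \<le> sqrt (t * M) * sqrt (1/2) ^ k"
    by (rule power2_le_imp_le) (use t M0 in simp)
  have path: "euler_path (Suc k) x t = euler (h/2) x (grid_index (Suc k) t)"
    by (simp add: euler_path_def h_def)
  have 2: "norm (euler (h/2) x (2 * ?i) - euler_path (Suc k) x t) \<le> G * sqrt (1/2) ^ k"
  proof -
    from grid_index_Suc[OF t, of k] show ?thesis
    proof
      assume "grid_index (Suc k) t = 2 * ?i"
      then show ?thesis using G0 by (simp add: path)
    next
      assume j: "grid_index (Suc k) t = Suc (2 * ?i)"
      have "real (Suc (2 * ?i)) * (h/2) \<le> t"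
        using grid_index_bounds(1)[OF t, of "Suc k"] unfolding j by (simp add: h_def)
      then have "norm (euler (h/2) x (Suc (2 * ?i)) - euler (h/2) x (2 * ?i)) \<le> h/2 * G"
        unfolding G_def using h by (intro norm_euler_step x) auto
      also have "\<dots> \<le> sqrt (1/2) ^ k * G"
      proof (intro mult_right_mono G0)
        have "h \<le> sqrt (1/2) ^ k"
          unfolding h_def by (intro power_mono real_le_rsqrt) (simp_all add: power2_eq_square)
        then show "h/2 \<le> sqrt (1/2) ^ k" using h by linarith
      qed
      finally show ?thesis unfolding path j by (simp add: norm_minus_commute mult.commute)
    qed
  qed
  have "norm (euler_path k x t - euler_path (Suc k) x t)
      \<le> norm (euler h x ?i - euler (h/2) x (2 * ?i)) + norm (euler (h/2) x (2 * ?i) - euler_path (Suc k) x t)"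
    unfolding euler_path_def[of k] h_def[symmetric]
    by (rule order_trans[OF _ norm_triangle_ineq]) simp
  also have "\<dots> \<le> (sqrt (t * M) + G) * sqrt (1/2) ^ k"
    using 1 2 by (simp add: distrib_right)
  finally show ?thesis unfolding M_def .
qed

lemma euler_path_tendsto:
  assumes x: "x \<in> D" and t: "0 \<le> t"
  shows "(\<lambda>k. euler_path k x t) \<longlonglongrightarrow> forward_solution x t"
proof -
  let ?p = "\<lambda>k. euler_path k x t"
  obtain K where K: "\<And>k. norm (?p k - ?p (Suc k)) \<le> K * sqrt (1/2) ^ k"
    using euler_path_Suc_diff[OF x t] by blast
  define s where "s n = (\<Sum>k<n. K * sqrt (1/2) ^ k)" for n
  have "sqrt (1/2) < 1" by simp
  then have "summable (\<lambda>k. K * sqrt (1/2) ^ k)" by (intro summable_mult summable_geometric) simp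
  then have "Cauchy s" unfolding s_def summable_iff_convergent by (rule convergent_Cauchy)
  moreover have "dist (?p m) (?p n) \<le> dist (s m) (s n)" for m n
  proof (induction m n rule: linorder_wlog)
    case (le m n)
    then have "norm (?p n - ?p m) \<le> s n - s m"
    proof (induction n rule: dec_induct)
      case (step n)
      have "norm (?p (Suc n) - ?p m) \<le> norm (?p n - ?p (Suc n)) + norm (?p n - ?p m)"
        using norm_triangle_ineq4[of "?p n - ?p m" "?p n - ?p (Suc n)"] by simp
      with step.IH K[of n] show ?case by (simp add: s_def)
    qed simp
    then show ?case by (simp add: dist_norm norm_minus_commute)
  qed (simp add: dist_commute)
  ultimately have "Cauchy ?p" unfolding Cauchy_def by (meson order_le_less_trans)
  then have "convergent ?p" by (rule Cauchy_convergent)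
  then show ?thesis unfolding forward_solution_def by (simp add: convergent_LIMSEQ_iff)
qed

lemma forward_solution_0: "x \<in> D \<Longrightarrow> forward_solution x 0 = x"
  using euler_path_tendsto[of x 0] by (simp add: LIMSEQ_const_iff)

lemma forward_solution_lipschitz:
  assumes x: "x \<in> D" and rt: "0 \<le> r" "r \<le> t" "t \<le> T"
  shows "norm (forward_solution x t - forward_solution x r) \<le> (t - r) * growth x T"
proof (rule LIMSEQ_le)
  have "0 \<le> t" using rt by simp
  then show "(\<lambda>k. norm (euler_path k x t - euler_path k x r))
      \<longlonglongrightarrow> norm (forward_solution x t - forward_solution x r)"
    by (intro tendsto_intros euler_path_tendsto x rt)
  have "(\<lambda>k. (t - r + (1/2) ^ k) * growth x T) \<longlonglongrightarrow> (t - r + 0) * growth x T"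
    by (intro tendsto_intros LIMSEQ_power_zero) simp
  then show "(\<lambda>k. (t - r + (1/2) ^ k) * growth x T) \<longlonglongrightarrow> (t - r) * growth x T" by simp
  show "\<exists>N. \<forall>k\<ge>N. norm (euler_path k x t - euler_path k x r) \<le> (t - r + (1/2) ^ k) * growth x T"
    using euler_path_lipschitz[OF assms] by blast
qed

text \<open>At the fixed time \<open>t\<close> the vectors \<open>A t\<close> applied to the
  approximants stay bounded. Moving \<open>A t\<close> to the test vector makes this a bound on a
  functional that survives the limit, so the limit belongs to the domain of the adjoint.\<close>

lemma forward_solution_in_D:
  assumes x: "x \<in> D" and t: "0 \<le> t"
  shows "forward_solution x t \<in> D"
proof -
  define G where "G = growth x t"
  \<comment> \<open>\<open>G\<close> controls the operator at the grid time below \<open>t\<close>;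
    the second summand pays for moving it to \<open>t\<close>, a distance of at most 1.\<close>
  define K where "K = G + C * (G + norm x)"
  have bound: "norm (A t (euler_path k x t)) \<le> K" for k
  proof -
    define h :: real where "h = (1/2) ^ k"
    let ?t = "real (grid_index k t) * h" and ?e = "euler_path k x t"
    have h: "0 < h" "h \<le> 1" by (auto simp: h_def power_le_one)
    have e: "?e \<in> D" by (rule euler_path_in_D[OF x])
    have t': "?t \<le> t" "\<bar>t - ?t\<bar> \<le> 1"
      using grid_index_bounds[OF t, of k] h unfolding h_def by auto
    have g: "norm (A ?t ?e) \<le> G"
      unfolding G_def euler_path_def h_def using t' by (intro norm_A_euler_le x) (auto simp: h_def)
    have "norm (A t ?e) \<le> norm (A ?t ?e) + norm (A t ?e - A ?t ?e)" by (rule norm_triangle_sub)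
    also have "\<dots> \<le> G + C * \<bar>t - ?t\<bar> * (norm (A ?t ?e) + norm ?e)"
      by (intro add_mono g A_lipschitz e)
    also have "\<dots> \<le> G + C * 1 * (G + norm x)"
      using t' C_nonneg g norm_euler_path[of k x t]
      by (intro add_left_mono mult_mono add_mono) auto
    finally show ?thesis by (simp add: K_def)
  qed
  have "\<bar>A t y \<bullet> forward_solution x t\<bar> \<le> K * norm y" if y: "y \<in> D" for y
  proof (rule LIMSEQ_le_const2)
    show "(\<lambda>k. \<bar>A t y \<bullet> euler_path k x t\<bar>) \<longlonglongrightarrow> \<bar>A t y \<bullet> forward_solution x t\<bar>"
      by (intro tendsto_intros euler_path_tendsto x t)
    have "\<bar>A t y \<bullet> euler_path k x t\<bar> \<le> K * norm y" for k
    proof -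
      have "\<bar>A t y \<bullet> euler_path k x t\<bar> = \<bar>A t (euler_path k x t) \<bullet> y\<bar>"
        unfolding skew_adjoint_skew[OF skew y euler_path_in_D[OF x]] by (simp add: inner_commute)
      also have "\<dots> \<le> norm (A t (euler_path k x t)) * norm y" by (rule Cauchy_Schwarz_ineq2)
      also have "\<dots> \<le> K * norm y" by (intro mult_right_mono bound) simp
      finally show ?thesis .
    qed
    then show "\<exists>N. \<forall>k\<ge>N. \<bar>A t y \<bullet> euler_path k x t\<bar> \<le> K * norm y" by blast
  qed
  then have "\<exists>z\<in>closure D. \<forall>y\<in>D. A t y \<bullet> forward_solution x t = y \<bullet> z"
    by (intro riesz_on_subspace D_subspace)
       (simp_all add: skew_adjoint_add[OF skew] skew_adjoint_scale[OF skew] inner_add_left)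
  then show ?thesis using skew_adjoint_domI[OF skew] by blast
qed

section \<open>The equation for the limit, tested against vectors of the domain\<close>

text \<open>Testing with \<open>y\<close> in \<open>D\<close> moves the operator from the iterates
  to \<open>y\<close>, where its time dependence is Lipschitz. Each step then costs
  \<open>h * \<delta>\<close> up to constants, so the sum is second order in the length. The
  reference index \<open>m\<close> is free so that the expansion can be made at any intermediate
  time.\<close>

lemma euler_weak_consistency:
  assumes h: "0 < h" and x: "x \<in> D" and y: "y \<in> D"
    and ij: "i \<le> m" "m \<le> j" and T: "real j * h \<le> T"
    and \<delta>: "(real j - real i) * h \<le> \<delta>" "\<And>l. i < l \<Longrightarrow> l \<le> j \<Longrightarrow> \<bar>real l * h - \<sigma>\<bar> \<le> \<delta>"
  shows "\<bar>(euler h x j - euler h x i) \<bullet> y + (real j - real i) * h * (euler h x m \<bullet> A \<sigma> y)\<bar>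
    \<le> (real j - real i) * h * (\<delta> * ((growth x T + C * norm x) * (norm (A \<sigma> y) + norm y)))"
proof -
  define G where "G = growth x T"
  define N where "N = norm (A \<sigma> y) + norm y"
  define e where "e = euler h x"
  have G0: "0 \<le> G" unfolding G_def using h by (intro growth_nonneg order_trans[OF _ T]) simp
  have N0: "0 \<le> N" "norm (A \<sigma> y) \<le> N" by (simp_all add: N_def)
  have \<delta>0: "0 \<le> \<delta>" by (rule order_trans[OF _ \<delta>(1)]) (use ij h in simp)
  have step: "\<bar>(e (Suc l) \<bullet> y - e l \<bullet> y) + h * (e m \<bullet> A \<sigma> y)\<bar> \<le> h * (\<delta> * ((G + C * norm x) * N))"
    if l: "l \<in> {i..<j}" for l
  proof -
    let ?t = "real (Suc l) * h"
    have lT: "?t \<le> T" using l h by (intro order_trans[OF _ T] mult_right_mono) auto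
    have eq: "e (Suc l) - e l = h *\<^sub>R A ?t (e (Suc l))"
      using euler_Suc_eq[OF h, of x l] unfolding e_def by (simp add: algebra_simps)
    have eD: "e (Suc l) \<in> D" unfolding e_def by (rule euler_in_D[OF h x])
    have "e (Suc l) \<bullet> y - e l \<bullet> y = h * (A ?t (e (Suc l)) \<bullet> y)"
      unfolding inner_diff_left[symmetric] eq by simp
    also have "\<dots> = - h * (e (Suc l) \<bullet> A ?t y)"
      using skew_adjoint_skew[OF skew eD y] by simp
    \<comment> \<open>The defect of one step separates into moving the iterate to index
      \<open>m\<close> and moving the time to \<open>\<sigma>\<close>.\<close>
    finally have split: "(e (Suc l) \<bullet> y - e l \<bullet> y) + h * (e m \<bullet> A \<sigma> y)
        = h * ((e m - e (Suc l)) \<bullet> A \<sigma> y - e (Suc l) \<bullet> (A ?t y - A \<sigma> y))"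
      by (simp add: algebra_simps)
    have "\<bar>(e m - e (Suc l)) \<bullet> A \<sigma> y - e (Suc l) \<bullet> (A ?t y - A \<sigma> y)\<bar> \<le> \<delta> * G * N + norm x * (C * \<delta> * N)"
    proof -
      have "norm (e m - e (Suc l)) \<le> \<bar>real m - real (Suc l)\<bar> * h * G"
      proof (cases "Suc l \<le> m")
        case True
        have "real m * h \<le> T" using ij h by (intro order_trans[OF _ T] mult_right_mono) auto
        from norm_euler_diff[OF h x True this] True show ?thesis
          by (simp add: e_def G_def del: euler.simps)
      next
        case False
        then have "m \<le> Suc l" by simp
        from norm_euler_diff[OF h x this lT] this show ?thesis
          by (simp add: e_def G_def norm_minus_commute del: euler.simps)
      qed
      also have "\<dots> \<le> (real j - real i) * h * G"
        using h G0 ij l by (intro mult_right_mono) auto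
      also have "\<dots> \<le> \<delta> * G" using \<delta>(1) G0 by (intro mult_right_mono)
      finally have 1: "norm (e m - e (Suc l)) \<le> \<delta> * G" .
      have "norm (A ?t y - A \<sigma> y) \<le> C * \<bar>?t - \<sigma>\<bar> * N"
        unfolding N_def by (rule A_lipschitz[OF y])
      also have "\<dots> \<le> C * \<delta> * N"
        using \<delta>(2)[of "Suc l"] l C_nonneg N0 by (intro mult_right_mono mult_left_mono) auto
      finally have 2: "norm (A ?t y - A \<sigma> y) \<le> C * \<delta> * N" .
      have "\<bar>(e m - e (Suc l)) \<bullet> A \<sigma> y\<bar> \<le> \<delta> * G * N"
        using 1 N0 \<delta>0 G0 by (intro order_trans[OF Cauchy_Schwarz_ineq2] mult_mono) auto
      moreover have "\<bar>e (Suc l) \<bullet> (A ?t y - A \<sigma> y)\<bar> \<le> norm x * (C * \<delta> * N)"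
        using 2 norm_euler[OF h, of x "Suc l"] unfolding e_def
        by (intro order_trans[OF Cauchy_Schwarz_ineq2] mult_mono) auto
      ultimately show ?thesis by linarith
    qed
    then have "h * \<bar>(e m - e (Suc l)) \<bullet> A \<sigma> y - e (Suc l) \<bullet> (A ?t y - A \<sigma> y)\<bar>
        \<le> h * (\<delta> * G * N + norm x * (C * \<delta> * N))"
      using h by simp
    also have "\<dots> = h * (\<delta> * ((G + C * norm x) * N))" by (simp add: algebra_simps)
    finally show ?thesis unfolding split abs_mult using h by simp
  qed
  have "(e j - e i) \<bullet> y + (real j - real i) * h * (e m \<bullet> A \<sigma> y)
      = (\<Sum>l=i..<j. (e (Suc l) \<bullet> y - e l \<bullet> y) + h * (e m \<bullet> A \<sigma> y))"
    using ij sum_Suc_diff'[of i j "\<lambda>l. e l \<bullet> y"] unfolding sum.distrib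
    by (simp add: inner_diff_left of_nat_diff)
  also have "\<bar>\<dots>\<bar> \<le> (\<Sum>l=i..<j. h * (\<delta> * ((G + C * norm x) * N)))"
    by (intro order_trans[OF sum_abs] sum_mono step)
  also have "\<dots> = (real j - real i) * h * (\<delta> * ((G + C * norm x) * N))"
    using ij by (simp add: of_nat_diff)
  finally show ?thesis unfolding e_def G_def N_def .
qed

text \<open>The reference time \<open>\<sigma>\<close> may be either endpoint. Both one-sided
  expansions at a point therefore come from the same estimate.\<close>

lemma forward_solution_weak:
  assumes x: "x \<in> D" and y: "y \<in> D" and r: "0 \<le> r" "r \<le> \<sigma>" "\<sigma> \<le> t" "t \<le> T"
  shows "\<bar>(forward_solution x t - forward_solution x r) \<bullet> y + (t - r) * (forward_solution x \<sigma> \<bullet> A \<sigma> y)\<bar>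
    \<le> (growth x T + C * norm x) * (norm (A \<sigma> y) + norm y) * (t - r)\<^sup>2"
proof -
  define K where "K = (growth x T + C * norm x) * (norm (A \<sigma> y) + norm y)"
  define N where "N = norm x * norm (A \<sigma> y)"
  let ?u = "forward_solution x" and ?p = "\<lambda>k. euler_path k x"
  have t: "0 \<le> t" and \<sigma>: "0 \<le> \<sigma>" using r by simp_all
  have K0: "0 \<le> K" unfolding K_def using growth_nonneg[of T x] t r C_nonneg by simp
  have bound: "\<bar>(?p k t - ?p k r) \<bullet> y + (t - r) * (?p k \<sigma> \<bullet> A \<sigma> y)\<bar>
      \<le> K * (t - r + (1/2) ^ k)\<^sup>2 + (1/2) ^ k * N" for k
  proof -
    define h :: real where "h = (1/2) ^ k"
    have h: "0 < h" by (simp add: h_def)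
    let ?i = "grid_index k r" and ?m = "grid_index k \<sigma>" and ?j = "grid_index k t"
    note gb = grid_index_bounds[OF t, of k, folded h_def] grid_index_bounds[OF r(1), of k, folded h_def]
    have im: "?i \<le> ?m" "?m \<le> ?j" using r by (auto intro: grid_index_mono)
    have d: "(real ?j - real ?i) * h \<le> t - r + h" "\<bar>(t - r) - (real ?j - real ?i) * h\<bar> \<le> h"
      using gb by (auto simp: algebra_simps abs_le_iff)
    have "\<bar>real l * h - \<sigma>\<bar> \<le> t - r + h" if "?i < l" "l \<le> ?j" for l
    proof -
      have "real ?i * h + h \<le> real l * h" using that(1) h
        by (metis Suc_leI add.commute distrib_right mult_1 mult_right_mono of_nat_Suc of_nat_le_iff less_imp_le)
      moreover have "real l * h \<le> real ?j * h" using that h by simp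
      ultimately show ?thesis using gb r h by linarith
    qed
    with d(1) have "\<bar>(?p k t - ?p k r) \<bullet> y + (real ?j - real ?i) * h * (?p k \<sigma> \<bullet> A \<sigma> y)\<bar>
        \<le> (real ?j - real ?i) * h * ((t - r + h) * K)"
      unfolding euler_path_def h_def[symmetric] K_def
      using gb r by (intro euler_weak_consistency h x y im) auto
    also have "\<dots> \<le> (t - r + h) * ((t - r + h) * K)"
      using d K0 r h by (intro mult_right_mono) auto
    finally have 1: "\<bar>(?p k t - ?p k r) \<bullet> y + (real ?j - real ?i) * h * (?p k \<sigma> \<bullet> A \<sigma> y)\<bar>
        \<le> K * (t - r + h)\<^sup>2" by (simp add: power2_eq_square mult_ac)
    \<comment> \<open>Replaces the distance of the grid points by \<open>t - r\<close>; rounding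
      contributes at most one step \<open>h\<close>.\<close>
    have "\<bar>((t - r) - (real ?j - real ?i) * h) * (?p k \<sigma> \<bullet> A \<sigma> y)\<bar> \<le> h * N"
      unfolding abs_mult N_def
      using d(2) h norm_euler_path[of k x \<sigma>]
      by (intro mult_mono order_trans[OF Cauchy_Schwarz_ineq2] mult_right_mono) auto
    with 1 show ?thesis unfolding h_def by (simp add: algebra_simps)
  qed
  have "\<bar>(?u t - ?u r) \<bullet> y + (t - r) * (?u \<sigma> \<bullet> A \<sigma> y)\<bar> \<le> K * (t - r + 0)\<^sup>2 + 0 * N"
  proof (rule LIMSEQ_le)
    show "(\<lambda>k. \<bar>(?p k t - ?p k r) \<bullet> y + (t - r) * (?p k \<sigma> \<bullet> A \<sigma> y)\<bar>)
        \<longlonglongrightarrow> \<bar>(?u t - ?u r) \<bullet> y + (t - r) * (?u \<sigma> \<bullet> A \<sigma> y)\<bar>"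
      by (intro tendsto_intros euler_path_tendsto x t r \<sigma>)
    show "(\<lambda>k. K * (t - r + (1/2) ^ k)\<^sup>2 + (1/2) ^ k * N) \<longlonglongrightarrow> K * (t - r + 0)\<^sup>2 + 0 * N"
      by (intro tendsto_intros LIMSEQ_power_zero) simp_all
  qed (use bound in blast)
  then show ?thesis unfolding K_def by simp
qed

end

subsection \<open>Weak and strong solutions on the real line\<close>

lemma skew_adjoint_scaleR:
  fixes B :: "'a::{real_inner, complete_space} \<Rightarrow> 'a"
  assumes B: "skew_adjoint D B" and c: "c \<noteq> 0"
  shows "skew_adjoint D (\<lambda>x. c *\<^sub>R B x)"
  unfolding skew_adjoint_def
proof (intro conjI ballI allI impI)
  fix y z assume *: "\<forall>x\<in>D. c *\<^sub>R B x \<bullet> y = x \<bullet> z"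
  have "B x \<bullet> y = x \<bullet> ((1/c) *\<^sub>R z)" if "x \<in> D" for x
    using *[rule_format, OF that] c by (simp add: field_simps)
  then show "y \<in> D" using skew_adjoint_domI[OF B] by blast
qed (simp_all add: skew_adjoint_subspace[OF B] skew_adjoint_dense[OF B] skew_adjoint_add[OF B]
      skew_adjoint_scale[OF B] skew_adjoint_skew[OF B] scaleR_add_right)

lemma has_real_derivative_if_quadratic:
  fixes f :: "real \<Rightarrow> real"
  assumes "\<forall>\<^sub>F \<tau> in at t. \<bar>f \<tau> - f t - c * (\<tau> - t)\<bar> \<le> K * (\<tau> - t)\<^sup>2"
  shows "(f has_real_derivative c) (at t)"
  unfolding has_field_derivative_iff
proof (rule LIM_zero_cancel, rule Lim_null_comparison)
  show "\<forall>\<^sub>F \<tau> in at t. norm ((f \<tau> - f t) / (\<tau> - t) - c) \<le> K * \<bar>\<tau> - t\<bar>"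
    using assms eventually_neq_at_within[of t t UNIV]
  proof eventually_elim
    case (elim \<tau>)
    have "norm ((f \<tau> - f t) / (\<tau> - t) - c) = \<bar>f \<tau> - f t - c * (\<tau> - t)\<bar> / \<bar>\<tau> - t\<bar>"
      using elim(2) by (simp add: abs_divide[symmetric] diff_divide_distrib)
    also have "\<dots> \<le> K * (\<tau> - t)\<^sup>2 / \<bar>\<tau> - t\<bar>" using elim(1) by (rule divide_right_mono) simp
    also have "\<dots> = K * \<bar>\<tau> - t\<bar>"
    proof -
      have "K * a\<^sup>2 / a = K * a" for a :: real by (simp add: power2_eq_square)
      from this[of "\<bar>\<tau> - t\<bar>"] show ?thesis by (simp only: power2_abs)
    qed
    finally show ?case .
  qed
  have "((\<lambda>\<tau>. K * \<bar>\<tau> - t\<bar>) \<longlongrightarrow> K * \<bar>t - t\<bar>) (at t)" by (intro tendsto_intros)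
  then show "((\<lambda>\<tau>. K * \<bar>\<tau> - t\<bar>) \<longlongrightarrow> 0) (at t)" by simp
qed

text \<open>Needed because the limit vector \<open>A t (u t)\<close> need not lie in
  \<open>D\<close>, whereas the weak equation can only be tested there. Boundedness of
  \<open>q\<close> carries the limit over to all test vectors.\<close>

lemma weak_tendsto_dense:
  fixes q :: "'b \<Rightarrow> 'a::real_inner"
  assumes dense: "closure D = UNIV" and D: "\<And>y. y \<in> D \<Longrightarrow> ((\<lambda>\<tau>. q \<tau> \<bullet> y) \<longlongrightarrow> a \<bullet> y) F"
    and bound: "\<forall>\<^sub>F \<tau> in F. norm (q \<tau>) \<le> M"
  shows "((\<lambda>\<tau>. q \<tau> \<bullet> z) \<longlongrightarrow> a \<bullet> z) F"
proof (rule tendstoI)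
  fix e :: real assume e: "e > 0"
  \<comment> \<open>\<open>M'\<close> eventually bounds \<open>norm (q \<tau> - a)\<close>; the
    added 1 makes it a legitimate denominator.\<close>
  define M' where "M' = \<bar>M\<bar> + norm a + 1"
  have M': "M' > 0" unfolding M'_def by (smt (verit) norm_ge_zero)
  have "z \<in> closure D" using dense by simp
  moreover have "e / (2 * M') > 0" using e M' by simp
  ultimately obtain y where y: "y \<in> D" and yz: "dist y z < e / (2 * M')"
    unfolding closure_approachable by blast
  have "\<forall>\<^sub>F \<tau> in F. dist (q \<tau> \<bullet> y) (a \<bullet> y) < e / 2" using D[OF y] e by (intro tendstoD) auto
  with bound show "\<forall>\<^sub>F \<tau> in F. dist (q \<tau> \<bullet> z) (a \<bullet> z) < e"
  proof eventually_elim
    case (elim \<tau>)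
    have "q \<tau> \<bullet> z - a \<bullet> z = (q \<tau> \<bullet> y - a \<bullet> y) + (q \<tau> - a) \<bullet> (z - y)"
      by (simp add: algebra_simps)
    moreover have "\<bar>(q \<tau> - a) \<bullet> (z - y)\<bar> \<le> M' * (e / (2 * M'))"
    proof (rule order_trans[OF Cauchy_Schwarz_ineq2], rule mult_mono)
      show "norm (q \<tau> - a) \<le> M'" unfolding M'_def
        using norm_triangle_ineq4[of "q \<tau>" a] elim by linarith
      show "norm (z - y) \<le> e / (2 * M')" using yz by (simp add: dist_norm norm_minus_commute)
    qed (use M' in auto)
    moreover have "M' * (e / (2 * M')) = e / 2" using M' by simp
    ultimately show ?case using elim unfolding dist_real_def by linarith
  qed
qed

text \<open>The Radon-Riesz argument: expanding the square of \<open>norm (q \<tau> - a)\<close>,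
  testing against \<open>a\<close> alone and an upper bound tending to \<open>norm a\<close>
  suffice.\<close>

lemma strong_tendsto_if_weak_tendsto:
  fixes q :: "'b \<Rightarrow> 'a::real_inner"
  assumes weak: "((\<lambda>\<tau>. q \<tau> \<bullet> a) \<longlongrightarrow> a \<bullet> a) F"
    and le: "\<forall>\<^sub>F \<tau> in F. norm (q \<tau>) \<le> w \<tau>" and w: "(w \<longlongrightarrow> norm a) F"
  shows "(q \<longlongrightarrow> a) F"
proof -
  have "((\<lambda>\<tau>. (norm (q \<tau> - a))\<^sup>2) \<longlongrightarrow> 0) F"
  proof (rule Lim_null_comparison)
    show "\<forall>\<^sub>F \<tau> in F. norm ((norm (q \<tau> - a))\<^sup>2) \<le> (w \<tau>)\<^sup>2 - 2 * (q \<tau> \<bullet> a) + (norm a)\<^sup>2"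
      using le
    proof eventually_elim
      case (elim \<tau>)
      have "(norm (q \<tau> - a))\<^sup>2 = (norm (q \<tau>))\<^sup>2 - 2 * (q \<tau> \<bullet> a) + (norm a)\<^sup>2"
        by (simp add: power2_norm_eq_inner algebra_simps inner_commute)
      moreover have "(norm (q \<tau>))\<^sup>2 \<le> (w \<tau>)\<^sup>2" using elim by (intro power_mono) auto
      ultimately have "(norm (q \<tau> - a))\<^sup>2 \<le> (w \<tau>)\<^sup>2 - 2 * (q \<tau> \<bullet> a) + (norm a)\<^sup>2" by linarith
      then show ?case by simp
    qed
    have "((\<lambda>\<tau>. (w \<tau>)\<^sup>2 - 2 * (q \<tau> \<bullet> a) + (norm a)\<^sup>2) \<longlongrightarrow> (norm a)\<^sup>2 - 2 * (a \<bullet> a) + (norm a)\<^sup>2) F"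
      by (intro tendsto_intros w weak)
    then show "((\<lambda>\<tau>. (w \<tau>)\<^sup>2 - 2 * (q \<tau> \<bullet> a) + (norm a)\<^sup>2) \<longlongrightarrow> 0) F"
      by (simp add: power2_norm_eq_inner)
  qed
  from tendsto_real_sqrt[OF this] show ?thesis by (simp add: tendsto_norm_zero_iff LIM_zero_iff)
qed

context skew_adjoint_family
begin

text \<open>The pointwise Lipschitz bound lets the product rule for \<open>u t \<bullet> u t\<close> hold although \<open>u\<close> is
  only weakly differentiable.\<close>

definition weak_solution :: "(real \<Rightarrow> 'a) \<Rightarrow> bool" where
  "weak_solution u \<longleftrightarrow> (\<forall>t. u t \<in> D
     \<and> (\<forall>y\<in>D. ((\<lambda>\<tau>. u \<tau> \<bullet> y) has_real_derivative A t (u t) \<bullet> y) (at t))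
     \<and> (\<exists>L. \<forall>\<^sub>F \<tau> in at t. norm (u \<tau> - u t) \<le> L * \<bar>\<tau> - t\<bar>))"

lemma weak_solution_lipschitz:
  "weak_solution u \<Longrightarrow> \<exists>L. \<forall>\<^sub>F \<tau> in at t. norm (u \<tau> - u t) \<le> L * \<bar>\<tau> - t\<bar>"
  by (simp add: weak_solution_def)

text \<open>For \<open>c = -1\<close> this reverses time about \<open>s\<close>, so that backward
  solutions become forward solutions of another family with the same constant; \<open>c = 1\<close>
  is a shift.\<close>

lemma reflected_family:
  assumes "\<bar>c\<bar> = 1"
  shows "skew_adjoint_family D (\<lambda>\<tau> x. c *\<^sub>R A (s + c * \<tau>) x) C"
proof
  have c: "c \<noteq> 0" using assms by auto
  show "skew_adjoint D (\<lambda>x. c *\<^sub>R A (s + c * t) x)" for t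
    by (rule skew_adjoint_scaleR[OF skew c])
  show "norm (c *\<^sub>R A (s + c * t) x - c *\<^sub>R A (s + c * r) x)
      \<le> C * \<bar>t - r\<bar> * (norm (c *\<^sub>R A (s + c * r) x) + norm x)" if "x \<in> D" for x t r
    using A_lipschitz[OF that, of "s + c * t" "s + c * r"] assms
    by (simp add: scaleR_diff_right[symmetric] right_diff_distrib[symmetric] abs_mult)
qed (rule C_nonneg)

text \<open>\<open>\<gamma>\<close> is \<open>growth\<close> of the shifted or reflected family. The
  times \<open>\<sigma>\<close> and \<open>\<tau>\<close> are unordered and \<open>K\<close> does
  not depend on them, which is what a two-sided derivative at \<open>\<sigma>\<close>
  requires.\<close>

lemma one_sided_solution:
  fixes s :: real
  assumes x: "x \<in> D" and c: "\<bar>c\<bar> = 1"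
  defines "\<gamma> \<equiv> \<lambda>T. exp (C * T) * (norm (A s x) + norm x) - norm x"
  shows "\<exists>v. v 0 = x \<and> (\<forall>\<tau>\<ge>0. v \<tau> \<in> D)
    \<and> (\<forall>\<sigma> \<tau> T. 0 \<le> \<sigma> \<longrightarrow> 0 \<le> \<tau> \<longrightarrow> \<sigma> \<le> T \<longrightarrow> \<tau> \<le> T \<longrightarrow> norm (v \<tau> - v \<sigma>) \<le> \<bar>\<tau> - \<sigma>\<bar> * \<gamma> T)
    \<and> (\<forall>y\<in>D. \<forall>T. \<exists>K. \<forall>\<sigma> \<tau>. 0 \<le> \<sigma> \<longrightarrow> 0 \<le> \<tau> \<longrightarrow> \<sigma> \<le> T \<longrightarrow> \<tau> \<le> T \<longrightarrow>
          \<bar>(v \<tau> - v \<sigma>) \<bullet> y - (\<tau> - \<sigma>) * c * (A (s + c * \<sigma>) (v \<sigma>) \<bullet> y)\<bar> \<le> K * (\<tau> - \<sigma>)\<^sup>2)"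
proof -
  interpret F: skew_adjoint_family D "\<lambda>\<tau> x. c *\<^sub>R A (s + c * \<tau>) x" C
    by (rule reflected_family[OF c])
  let ?v = "F.forward_solution x"
  have \<gamma>: "F.growth x T = \<gamma> T" for T
    unfolding F.growth_def \<gamma>_def using c by simp
  have lip: "norm (?v \<tau> - ?v \<sigma>) \<le> \<bar>\<tau> - \<sigma>\<bar> * \<gamma> T"
    if "0 \<le> \<sigma>" "0 \<le> \<tau>" "\<sigma> \<le> T" "\<tau> \<le> T" for \<sigma> \<tau> T
  proof (cases "\<sigma> \<le> \<tau>")
    case True
    then show ?thesis using F.forward_solution_lipschitz[OF x that(1) True that(4)] by (simp add: \<gamma>)
  next
    case False
    then have "\<tau> \<le> \<sigma>" by simp
    from F.forward_solution_lipschitz[OF x that(2) this that(3)] this show ?thesis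
      by (simp add: \<gamma> norm_minus_commute)
  qed
  have weak: "\<exists>K. \<forall>\<sigma> \<tau>. 0 \<le> \<sigma> \<longrightarrow> 0 \<le> \<tau> \<longrightarrow> \<sigma> \<le> T \<longrightarrow> \<tau> \<le> T \<longrightarrow>
      \<bar>(?v \<tau> - ?v \<sigma>) \<bullet> y - (\<tau> - \<sigma>) * c * (A (s + c * \<sigma>) (?v \<sigma>) \<bullet> y)\<bar> \<le> K * (\<tau> - \<sigma>)\<^sup>2"
    if y: "y \<in> D" for y T
  proof (intro exI allI impI)
    fix \<sigma> \<tau> :: real assume \<sigma>: "0 \<le> \<sigma>" and \<tau>: "0 \<le> \<tau>" and T: "\<sigma> \<le> T" "\<tau> \<le> T"
    let ?B = "\<lambda>\<tau> x. c *\<^sub>R A (s + c * \<tau>) x"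
    let ?N = "norm (A s y) + norm y"
    let ?G = "\<gamma> T + C * norm x"
    have v: "?v \<sigma> \<in> D" by (rule F.forward_solution_in_D[OF x \<sigma>])
    have skew\<sigma>: "?v \<sigma> \<bullet> ?B \<sigma> y = - (c * (A (s + c * \<sigma>) (?v \<sigma>) \<bullet> y))"
      using skew_adjoint_skew[OF F.skew[of \<sigma>] v y] by simp
    have "0 \<le> F.growth x T" using \<sigma> T by (intro F.growth_nonneg) simp
    then have G0: "0 \<le> ?G" using C_nonneg by (simp add: \<gamma>)
    \<comment> \<open>Comparing the operator at \<open>\<sigma>\<close> with the one at 0 makes the
      constant uniform over all \<open>\<sigma>\<close> up to \<open>T\<close>.\<close>
    have "norm (?B \<sigma> y) + norm y \<le> (1 + C * T) * ?N"
    proof -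
      have "norm (?B \<sigma> y) \<le> norm (?B 0 y) + norm (?B \<sigma> y - ?B 0 y)" by (rule norm_triangle_sub)
      also have "\<dots> \<le> norm (?B 0 y) + C * \<bar>\<sigma> - 0\<bar> * (norm (?B 0 y) + norm y)"
        by (intro add_left_mono F.A_lipschitz y)
      also have "\<dots> \<le> norm (?B 0 y) + C * T * (norm (?B 0 y) + norm y)"
        using \<sigma> T C_nonneg by (intro add_left_mono mult_right_mono mult_left_mono) auto
      finally show ?thesis using c by (simp add: algebra_simps)
    qed
    then have K: "?G * (norm (?B \<sigma> y) + norm y) * (\<tau> - \<sigma>)\<^sup>2
        \<le> ?G * ((1 + C * T) * ?N) * (\<tau> - \<sigma>)\<^sup>2"
      using G0 by (intro mult_right_mono mult_left_mono) auto
    have "\<bar>(?v \<tau> - ?v \<sigma>) \<bullet> y + (\<tau> - \<sigma>) * (?v \<sigma> \<bullet> ?B \<sigma> y)\<bar> \<le> ?G * (norm (?B \<sigma> y) + norm y) * (\<tau> - \<sigma>)\<^sup>2"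
    \<comment> \<open>The base point \<open>\<sigma>\<close> is the left endpoint in one case and
      the right endpoint in the other.\<close>
    proof (cases "\<sigma> \<le> \<tau>")
      case True
      show ?thesis using F.forward_solution_weak[OF x y \<sigma> order_refl True T(2)] by (simp add: \<gamma>)
    next
      case False
      then have "\<tau> \<le> \<sigma>" by simp
      from F.forward_solution_weak[OF x y \<tau> this order_refl T(1)]
      have "\<bar>(?v \<sigma> - ?v \<tau>) \<bullet> y + (\<sigma> - \<tau>) * (?v \<sigma> \<bullet> ?B \<sigma> y)\<bar> \<le> ?G * (norm (?B \<sigma> y) + norm y) * (\<tau> - \<sigma>)\<^sup>2"
        by (simp only: \<gamma> power2_commute)
      moreover have "(?v \<sigma> - ?v \<tau>) \<bullet> y + (\<sigma> - \<tau>) * (?v \<sigma> \<bullet> ?B \<sigma> y)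
          = - ((?v \<tau> - ?v \<sigma>) \<bullet> y + (\<tau> - \<sigma>) * (?v \<sigma> \<bullet> ?B \<sigma> y))"
        by (simp only: inner_diff_left left_diff_distrib)
      ultimately show ?thesis by (simp only: abs_minus_cancel)
    qed
    also note K
    finally show "\<bar>(?v \<tau> - ?v \<sigma>) \<bullet> y - (\<tau> - \<sigma>) * c * (A (s + c * \<sigma>) (?v \<sigma>) \<bullet> y)\<bar>
        \<le> ?G * ((1 + C * T) * ?N) * (\<tau> - \<sigma>)\<^sup>2"
      unfolding skew\<sigma> by (simp add: mult.assoc)
  qed
  show ?thesis
    using F.forward_solution_0[OF x] F.forward_solution_in_D[OF x] lip weak
    by (intro exI[of _ ?v]) blast
qed

text \<open>A forward and a reflected solution are joined at \<open>s\<close>. In the last clause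
  the factor after \<open>\<bar>t - s\<bar>\<close> tends to \<open>norm (A s x)\<close> as
  \<open>t\<close> approaches \<open>s\<close>; this sharpness is what later yields strong
  differentiability.\<close>

lemma weak_solution_exists:
  assumes x: "x \<in> D"
  shows "\<exists>u. weak_solution u \<and> u s = x \<and>
    (\<forall>t. norm (u t - u s) \<le> \<bar>t - s\<bar> * (exp (C * \<bar>t - s\<bar>) * (norm (A s x) + norm x) - norm x))"
proof -
  define \<gamma> where "\<gamma> T = exp (C * T) * (norm (A s x) + norm x) - norm x" for T
  obtain v where v: "v 0 = x" "\<And>\<tau>. 0 \<le> \<tau> \<Longrightarrow> v \<tau> \<in> D"
    "\<And>\<sigma> \<tau> T. 0 \<le> \<sigma> \<Longrightarrow> 0 \<le> \<tau> \<Longrightarrow> \<sigma> \<le> T \<Longrightarrow> \<tau> \<le> T \<Longrightarrow> norm (v \<tau> - v \<sigma>) \<le> \<bar>\<tau> - \<sigma>\<bar> * \<gamma> T"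
    and v_weak: "\<And>y T. y \<in> D \<Longrightarrow> \<exists>K. \<forall>\<sigma> \<tau>. 0 \<le> \<sigma> \<longrightarrow> 0 \<le> \<tau> \<longrightarrow> \<sigma> \<le> T \<longrightarrow> \<tau> \<le> T \<longrightarrow>
          \<bar>(v \<tau> - v \<sigma>) \<bullet> y - (\<tau> - \<sigma>) * (A (s + \<sigma>) (v \<sigma>) \<bullet> y)\<bar> \<le> K * (\<tau> - \<sigma>)\<^sup>2"
    using one_sided_solution[OF x, of 1 s, folded \<gamma>_def] by (simp only: mult_1 mult_1_right) fastforce
  obtain w where w: "w 0 = x" "\<And>\<tau>. 0 \<le> \<tau> \<Longrightarrow> w \<tau> \<in> D"
    "\<And>\<sigma> \<tau> T. 0 \<le> \<sigma> \<Longrightarrow> 0 \<le> \<tau> \<Longrightarrow> \<sigma> \<le> T \<Longrightarrow> \<tau> \<le> T \<Longrightarrow> norm (w \<tau> - w \<sigma>) \<le> \<bar>\<tau> - \<sigma>\<bar> * \<gamma> T"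
    and w_weak: "\<And>y T. y \<in> D \<Longrightarrow> \<exists>K. \<forall>\<sigma> \<tau>. 0 \<le> \<sigma> \<longrightarrow> 0 \<le> \<tau> \<longrightarrow> \<sigma> \<le> T \<longrightarrow> \<tau> \<le> T \<longrightarrow>
          \<bar>(w \<tau> - w \<sigma>) \<bullet> y - (\<tau> - \<sigma>) * (-1) * (A (s + (-1) * \<sigma>) (w \<sigma>) \<bullet> y)\<bar> \<le> K * (\<tau> - \<sigma>)\<^sup>2"
    using one_sided_solution[OF x, of "-1" s, folded \<gamma>_def] by fastforce
  define u where "u t = (if s \<le> t then v (t - s) else w (s - t))" for t
  have uv: "u t = v (t - s)" if "s \<le> t" for t using that by (simp add: u_def)
  have uw: "u t = w (s - t)" if "t \<le> s" for t using that v(1) w(1) by (cases "t = s") (simp_all add: u_def)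
  have us: "u s = x" using uv[of s] v(1) by simp
  have uD: "u t \<in> D" for t using v(2) w(2) by (simp add: u_def)
  \<comment> \<open>Away from \<open>s\<close>, nearby times stay on the side of \<open>t\<close>;
    at \<open>t = s\<close> either side is admissible, as both halves start there. The radius 1 is
    matched by the extra 1 in \<open>T\<close> below.\<close>
  have same_side: "\<forall>\<^sub>F \<tau> in at t. \<bar>\<tau> - t\<bar> < 1 \<and> (s \<le> t \<and> s \<le> \<tau> \<or> t \<le> s \<and> \<tau> \<le> s)" for t
    unfolding eventually_at
    by (rule exI[of _ "if t = s then 1 else min 1 \<bar>t - s\<bar>"]) (auto simp: dist_real_def)
  have "weak_solution u"
    unfolding weak_solution_def
  proof (intro allI conjI ballI uD)
    fix t
    define T where "T = \<bar>t - s\<bar> + 1"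
    show "\<exists>L. \<forall>\<^sub>F \<tau> in at t. norm (u \<tau> - u t) \<le> L * \<bar>\<tau> - t\<bar>"
    proof (rule exI[of _ "\<gamma> T"])
      show "\<forall>\<^sub>F \<tau> in at t. norm (u \<tau> - u t) \<le> \<gamma> T * \<bar>\<tau> - t\<bar>"
        using same_side[of t]
      proof eventually_elim
        case (elim \<tau>)
        then have "\<bar>\<tau> - t\<bar> < 1" by simp
        from elim have "s \<le> t \<and> s \<le> \<tau> \<or> t \<le> s \<and> \<tau> \<le> s" by simp
        then show ?case
        proof
          assume *: "s \<le> t \<and> s \<le> \<tau>"
          then show ?thesis using v(3)[of "t - s" "\<tau> - s" T] elim
            by (simp add: uv T_def mult.commute)
        next
          assume *: "t \<le> s \<and> \<tau> \<le> s"
          then show ?thesis using w(3)[of "s - t" "s - \<tau>" T] elim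
            by (simp add: uw T_def mult.commute abs_minus_commute)
        qed
      qed
    qed
    fix y assume y: "y \<in> D"
    obtain K1 where K1: "\<And>\<sigma> \<tau>. 0 \<le> \<sigma> \<Longrightarrow> 0 \<le> \<tau> \<Longrightarrow> \<sigma> \<le> T \<Longrightarrow> \<tau> \<le> T \<Longrightarrow>
        \<bar>(v \<tau> - v \<sigma>) \<bullet> y - (\<tau> - \<sigma>) * (A (s + \<sigma>) (v \<sigma>) \<bullet> y)\<bar> \<le> K1 * (\<tau> - \<sigma>)\<^sup>2"
      using v_weak[OF y, of T] by blast
    obtain K2 where K2: "\<And>\<sigma> \<tau>. 0 \<le> \<sigma> \<Longrightarrow> 0 \<le> \<tau> \<Longrightarrow> \<sigma> \<le> T \<Longrightarrow> \<tau> \<le> T \<Longrightarrow>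
        \<bar>(w \<tau> - w \<sigma>) \<bullet> y - (\<tau> - \<sigma>) * (-1) * (A (s + (-1) * \<sigma>) (w \<sigma>) \<bullet> y)\<bar> \<le> K2 * (\<tau> - \<sigma>)\<^sup>2"
      using w_weak[OF y, of T] by blast
    show "((\<lambda>\<tau>. u \<tau> \<bullet> y) has_real_derivative A t (u t) \<bullet> y) (at t)"
    proof (rule has_real_derivative_if_quadratic)
      show "\<forall>\<^sub>F \<tau> in at t. \<bar>u \<tau> \<bullet> y - u t \<bullet> y - A t (u t) \<bullet> y * (\<tau> - t)\<bar> \<le> max K1 K2 * (\<tau> - t)\<^sup>2"
        using same_side[of t]
      proof eventually_elim
        case (elim \<tau>)
        then have near: "\<bar>\<tau> - t\<bar> < 1" by simp
        have "\<bar>u \<tau> \<bullet> y - u t \<bullet> y - A t (u t) \<bullet> y * (\<tau> - t)\<bar> \<le> K1 * (\<tau> - t)\<^sup>2 \<or>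
          \<bar>u \<tau> \<bullet> y - u t \<bullet> y - A t (u t) \<bullet> y * (\<tau> - t)\<bar> \<le> K2 * (\<tau> - t)\<^sup>2"
        proof (cases "s \<le> t \<and> s \<le> \<tau>")
          case True
          then show ?thesis using K1[of "t - s" "\<tau> - s"] near
            by (simp add: uv T_def inner_diff_left mult.commute)
        next
          case False
          then have *: "t \<le> s" "\<tau> \<le> s" using elim by auto
          then show ?thesis using K2[of "s - t" "s - \<tau>"] near
            by (simp add: uw T_def inner_diff_left mult.commute power2_commute)
        qed
        moreover have "K1 * (\<tau> - t)\<^sup>2 \<le> max K1 K2 * (\<tau> - t)\<^sup>2" "K2 * (\<tau> - t)\<^sup>2 \<le> max K1 K2 * (\<tau> - t)\<^sup>2"
          by (auto intro: mult_right_mono)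
        ultimately show ?case by linarith
      qed
    qed
  qed
  moreover have "norm (u t - u s) \<le> \<bar>t - s\<bar> * \<gamma> \<bar>t - s\<bar>" for t
  proof (cases "s \<le> t")
    case True
    then show ?thesis using v(3)[of 0 "t - s" "t - s"] by (simp add: uv)
  next
    case False
    then show ?thesis using w(3)[of 0 "s - t" "s - t"] by (simp add: uw)
  qed
  ultimately show ?thesis using us unfolding \<gamma>_def by blast
qed

lemma weak_solution_diff:
  assumes "weak_solution u" "weak_solution v"
  shows "weak_solution (\<lambda>t. u t - v t)"
  unfolding weak_solution_def
proof (intro allI conjI ballI)
  fix t
  have u: "u t \<in> D" and v: "v t \<in> D" using assms by (auto simp: weak_solution_def)
  then show "u t - v t \<in> D" by (intro subspace_diff D_subspace)
  obtain L M where "\<forall>\<^sub>F \<tau> in at t. norm (u \<tau> - u t) \<le> L * \<bar>\<tau> - t\<bar>"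
    "\<forall>\<^sub>F \<tau> in at t. norm (v \<tau> - v t) \<le> M * \<bar>\<tau> - t\<bar>"
    using weak_solution_lipschitz[OF assms(1), of t] weak_solution_lipschitz[OF assms(2), of t] by blast
  then have "\<forall>\<^sub>F \<tau> in at t. norm ((u \<tau> - v \<tau>) - (u t - v t)) \<le> (L + M) * \<bar>\<tau> - t\<bar>"
  proof eventually_elim
    case (elim \<tau>)
    then show ?case using norm_triangle_ineq4[of "u \<tau> - u t" "v \<tau> - v t"]
      by (simp add: algebra_simps)
  qed
  then show "\<exists>L. \<forall>\<^sub>F \<tau> in at t. norm ((u \<tau> - v \<tau>) - (u t - v t)) \<le> L * \<bar>\<tau> - t\<bar>" by blast
  fix y assume "y \<in> D"
  then have "((\<lambda>\<tau>. u \<tau> \<bullet> y) has_real_derivative A t (u t) \<bullet> y) (at t)"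
    "((\<lambda>\<tau>. v \<tau> \<bullet> y) has_real_derivative A t (v t) \<bullet> y) (at t)"
    using assms by (auto simp: weak_solution_def)
  from DERIV_diff[OF this]
  show "((\<lambda>\<tau>. (u \<tau> - v \<tau>) \<bullet> y) has_real_derivative A t (u t - v t) \<bullet> y) (at t)"
    by (simp add: inner_diff_left skew_adjoint_diff[OF skew u v])
qed

lemma weak_solution_norm:
  assumes u: "weak_solution u"
  shows "norm (u t) = norm (u s)"
proof -
  have "((\<lambda>\<tau>. u \<tau> \<bullet> u \<tau>) has_real_derivative 0) (at t)" for t
  proof -
    have ut: "u t \<in> D" using u by (simp add: weak_solution_def)
    obtain L where L: "\<forall>\<^sub>F \<tau> in at t. norm (u \<tau> - u t) \<le> L * \<bar>\<tau> - t\<bar>"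
      using weak_solution_lipschitz[OF u] by blast
    have "((\<lambda>\<tau>. u \<tau> \<bullet> u t) has_real_derivative A t (u t) \<bullet> u t) (at t)"
      using u ut by (simp add: weak_solution_def)
    then have 1: "((\<lambda>\<tau>. u \<tau> \<bullet> u t) has_real_derivative 0) (at t)"
      using skew_adjoint_self[OF skew ut] by simp
    have 2: "((\<lambda>\<tau>. (norm (u \<tau> - u t))\<^sup>2) has_real_derivative 0) (at t)"
    proof (rule has_real_derivative_if_quadratic)
      show "\<forall>\<^sub>F \<tau> in at t. \<bar>(norm (u \<tau> - u t))\<^sup>2 - (norm (u t - u t))\<^sup>2 - 0 * (\<tau> - t)\<bar> \<le> L\<^sup>2 * (\<tau> - t)\<^sup>2"
        using L
      proof eventually_elim
        case (elim \<tau>)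
        then have "(norm (u \<tau> - u t))\<^sup>2 \<le> (L * \<bar>\<tau> - t\<bar>)\<^sup>2" by (intro power_mono) auto
        then show ?case by (simp add: power_mult_distrib)
      qed
    qed
    \<comment> \<open>Expansion about the fixed vector \<open>u t\<close> of \<open>D\<close>: the
      linear part is covered by the weak equation and has derivative 0 by skewness, the remainder is
      quadratic by the Lipschitz bound.\<close>
    have "(\<lambda>\<tau>. u \<tau> \<bullet> u \<tau>) = (\<lambda>\<tau>. 2 * (u \<tau> \<bullet> u t) + (norm (u \<tau> - u t))\<^sup>2 - u t \<bullet> u t)"
      by (simp add: fun_eq_iff power2_norm_eq_inner algebra_simps inner_commute)
    moreover have "(\<dots> has_real_derivative 2 * 0 + 0 - 0) (at t)"
      by (intro derivative_intros DERIV_cmult 1 2)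
    ultimately show ?thesis by simp
  qed
  then have "u t \<bullet> u t = u s \<bullet> u s"
    using DERIV_isconst_all[of "\<lambda>\<tau>. u \<tau> \<bullet> u \<tau>" t s] by blast
  then show ?thesis by (simp add: norm_eq_sqrt_inner)
qed

lemma weak_solution_unique:
  assumes "weak_solution u" "weak_solution v" "u s = v s"
  shows "u = v"
proof
  fix t
  show "u t = v t" using weak_solution_norm[OF weak_solution_diff[OF assms(1,2)], of t s] assms(3) by simp
qed

lemma weak_solution_strong:
  assumes u: "weak_solution u"
  shows "(u has_vector_derivative A t (u t)) (at t)"
proof -
  define a where "a = A t (u t)"
  define w where "w \<tau> = exp (C * \<bar>\<tau> - t\<bar>) * (norm a + norm (u t)) - norm (u t)" for \<tau>
  define q where "q \<tau> = (1 / (\<tau> - t)) *\<^sub>R (u \<tau> - u t)" for \<tau>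
  have ut: "u t \<in> D" using u by (simp add: weak_solution_def)
  obtain v where v: "weak_solution v" "v t = u t"
      "\<And>\<tau>. norm (v \<tau> - v t) \<le> \<bar>\<tau> - t\<bar> * w \<tau>"
    using weak_solution_exists[OF ut, of t] unfolding w_def a_def by blast
  \<comment> \<open>The sharp bound is available only at the starting time. Uniqueness transfers it
    from the solution restarted at \<open>t\<close> to \<open>u\<close> itself.\<close>
  have "u = v" by (rule weak_solution_unique[OF u v(1) v(2)[symmetric]])
  then have sharp: "norm (u \<tau> - u t) \<le> \<bar>\<tau> - t\<bar> * w \<tau>" for \<tau> using v(3) by simp
  have qw: "\<forall>\<^sub>F \<tau> in at t. norm (q \<tau>) \<le> w \<tau>"
    using eventually_neq_at_within[of t t UNIV]
  proof eventually_elim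
    case (elim \<tau>)
    then show ?case using sharp[of \<tau>] by (simp add: q_def pos_divide_le_eq mult.commute)
  qed
  have "(w \<longlongrightarrow> exp (C * \<bar>t - t\<bar>) * (norm a + norm (u t)) - norm (u t)) (at t)"
    unfolding w_def by (intro tendsto_intros)
  then have w: "(w \<longlongrightarrow> norm a) (at t)" by simp
  have bounded: "\<forall>\<^sub>F \<tau> in at t. norm (q \<tau>) \<le> norm a + 1"
    using qw order_tendstoD(2)[OF w less_add_one] by eventually_elim simp
  have "((\<lambda>\<tau>. q \<tau> \<bullet> y) \<longlongrightarrow> a \<bullet> y) (at t)" if "y \<in> D" for y
    using u that unfolding weak_solution_def has_field_derivative_iff q_def a_def
    by (simp add: inner_diff_left)
  then have "((\<lambda>\<tau>. q \<tau> \<bullet> a) \<longlongrightarrow> a \<bullet> a) (at t)"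
    by (rule weak_tendsto_dense[OF skew_adjoint_dense[OF skew] _ bounded])
  then have "(q \<longlongrightarrow> a) (at t)" by (rule strong_tendsto_if_weak_tendsto[OF _ qw w])
  then have "((\<lambda>\<tau>. norm (q \<tau> - a)) \<longlongrightarrow> 0) (at t)" by (simp add: tendsto_norm_zero_iff LIM_zero_iff)
  then have "((\<lambda>\<tau>. norm ((u \<tau> - u t) - (\<tau> - t) *\<^sub>R a) / norm (\<tau> - t)) \<longlongrightarrow> 0) (at t)"
  proof (rule Lim_transform_eventually)
    show "\<forall>\<^sub>F \<tau> in at t. norm (q \<tau> - a) = norm ((u \<tau> - u t) - (\<tau> - t) *\<^sub>R a) / norm (\<tau> - t)"
      using eventually_neq_at_within[of t t UNIV]
    proof eventually_elim
      case (elim \<tau>)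
      then have "q \<tau> - a = (1 / (\<tau> - t)) *\<^sub>R ((u \<tau> - u t) - (\<tau> - t) *\<^sub>R a)"
        by (simp add: q_def scaleR_diff_right)
      then show ?case by simp
    qed
  qed
  then show ?thesis
    unfolding has_vector_derivative_def has_derivative_iff_norm a_def
    by (simp add: bounded_linear_scaleR_left)
qed

theorem strong_solution_exists:
  assumes "x \<in> D"
  shows "\<exists>u. u s = x \<and> (\<forall>t. u t \<in> D \<and> (u has_vector_derivative A t (u t)) (at t))"
proof -
  obtain u where u: "weak_solution u" "u s = x" using weak_solution_exists[OF assms] by blast
  then have "u t \<in> D" for t by (simp add: weak_solution_def)
  with u weak_solution_strong[OF u(1)] show ?thesis by blast
qed

end

subsection \<open>The propagator on an interval\<close>

lemma dense_eqI:
  fixes f g :: "'a::metric_space \<Rightarrow> 'b::metric_space"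
  assumes dense: "closure D = UNIV" and "continuous_on UNIV f" "continuous_on UNIV g"
    and eq: "\<And>x. x \<in> D \<Longrightarrow> f x = g x"
  shows "f x = g x"
proof -
  obtain X where X: "\<And>n. X n \<in> D" "X \<longlonglongrightarrow> x"
    using dense closure_sequential[of x D] by auto
  have "(\<lambda>n. f (X n)) \<longlonglongrightarrow> f x" "(\<lambda>n. g (X n)) \<longlonglongrightarrow> g x"
    using assms(2,3) X(2) by (auto intro: continuous_on_tendsto_compose)
  then show ?thesis using eq[OF X(1)] LIMSEQ_unique by simp
qed

lemma isometry_continuous:
  assumes "\<And>x y. dist (g x) (g y) = dist x y"
  shows "continuous_on S g"
  unfolding continuous_on_iff using assms by auto

text \<open>The extension comes from uniform continuity. Equality of distances then spreads from
  \<open>D\<close> to the space one argument at a time, both sides being continuous.\<close>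

lemma dense_isometry_extension:
  fixes T :: "'a::metric_space \<Rightarrow> 'b::complete_space"
  assumes dense: "closure D = UNIV" and iso: "\<And>x y. x \<in> D \<Longrightarrow> y \<in> D \<Longrightarrow> dist (T x) (T y) = dist x y"
  shows "\<exists>g. (\<forall>x\<in>D. g x = T x) \<and> (\<forall>x y. dist (g x) (g y) = dist x y)"
proof -
  have "uniformly_continuous_on D T" unfolding uniformly_continuous_on_def using iso by metis
  then obtain g where g: "uniformly_continuous_on (closure D) g" "\<And>x. x \<in> D \<Longrightarrow> T x = g x"
    using uniformly_continuous_on_extension_on_closure by metis
  have cont: "continuous_on UNIV g" using g(1) dense uniformly_continuous_imp_continuous by metis
  have 1: "dist (g x) (g y) = dist x y" if "y \<in> D" for x y
    by (rule dense_eqI[OF dense, where f = "\<lambda>x. dist (g x) (g y)" and g = "\<lambda>x. dist x y"])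
       (use that iso g(2) in \<open>auto intro!: continuous_intros cont\<close>)
  have "dist (g x) (g y) = dist x y" for x y
    by (rule dense_eqI[OF dense, where f = "\<lambda>y. dist (g x) (g y)" and g = "\<lambda>y. dist x y"])
       (use 1 in \<open>auto intro!: continuous_intros cont\<close>)
  with g(2) show ?thesis by metis
qed

text \<open>The constant is allowed to depend on the compact subinterval, since the derivatives of
  the coefficients may be unbounded on \<open>I\<close>.\<close>

locale skew_adjoint_evolution =
  fixes D :: "'a::{real_inner, complete_space} set" and A :: "real \<Rightarrow> 'a \<Rightarrow> 'a" and I :: "real set"
  assumes interval: "is_interval I"
    and skew: "t \<in> I \<Longrightarrow> skew_adjoint D (A t)"
    and locally_lipschitz: "a \<le> b \<Longrightarrow> {a..b} \<subseteq> I \<Longrightarrow>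
      \<exists>C\<ge>0. \<forall>t\<in>{a..b}. \<forall>r\<in>{a..b}. \<forall>x\<in>D. norm (A t x - A r x) \<le> C * \<bar>t - r\<bar> * (norm (A r x) + norm x)"
begin

definition solves_on :: "real set \<Rightarrow> (real \<Rightarrow> 'a) \<Rightarrow> bool" where
  "solves_on S u \<longleftrightarrow> (\<forall>t\<in>S. u t \<in> D \<and> (u has_vector_derivative A t (u t)) (at t within S))"

lemma solves_on_subset: "solves_on T u \<Longrightarrow> S \<subseteq> T \<Longrightarrow> solves_on S u"
  unfolding solves_on_def by (meson has_vector_derivative_within_subset subset_iff)

lemma solves_on_norm:
  assumes u: "solves_on S u" and S: "convex S" "S \<subseteq> I" and st: "s \<in> S" "t \<in> S"
  shows "norm (u t) = norm (u s)"
proof -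
  have "((\<lambda>t. u t \<bullet> u t) has_real_derivative 0) (at t within S)" if t: "t \<in> S" for t
  proof -
    have ut: "u t \<in> D" and "(u has_vector_derivative A t (u t)) (at t within S)"
      using u t by (auto simp: solves_on_def)
    then have d: "(u has_derivative (\<lambda>h. h *\<^sub>R A t (u t))) (at t within S)"
      by (simp add: has_vector_derivative_def)
    have "((\<lambda>t. u t \<bullet> u t) has_derivative (\<lambda>h. u t \<bullet> (h *\<^sub>R A t (u t)) + (h *\<^sub>R A t (u t)) \<bullet> u t)) (at t within S)"
      by (rule has_derivative_inner[OF d d])
    moreover have "A t (u t) \<bullet> u t = 0" using skew_adjoint_self[OF skew ut] t S by blast
    ultimately show ?thesis by (simp add: has_field_derivative_def inner_commute lambda_zero)
  qed
  then obtain c where "\<forall>t\<in>S. u t \<bullet> u t = c" using has_field_derivative_zero_constant[OF S(1)] by blast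
  then show ?thesis using st by (simp add: norm_eq_sqrt_inner)
qed

lemma solves_on_diff:
  assumes u: "solves_on S u" and v: "solves_on S v" and S: "S \<subseteq> I"
  shows "solves_on S (\<lambda>t. u t - v t)"
  unfolding solves_on_def
proof (intro ballI conjI)
  fix t assume t: "t \<in> S"
  then have skt: "skew_adjoint D (A t)" using S skew by blast
  have D: "u t \<in> D" "v t \<in> D" using u v t by (auto simp: solves_on_def)
  then show "u t - v t \<in> D" by (intro subspace_diff[OF skew_adjoint_subspace[OF skt]])
  show "((\<lambda>t. u t - v t) has_vector_derivative A t (u t - v t)) (at t within S)"
    unfolding skew_adjoint_diff[OF skt D]
    using u v t by (intro has_vector_derivative_diff) (auto simp: solves_on_def)
qed

lemma solves_on_unique:
  assumes u: "solves_on S u" and v: "solves_on S v" and S: "convex S" "S \<subseteq> I"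
    and st: "s \<in> S" "t \<in> S" and eq: "u s = v s"
  shows "u t = v t"
  using solves_on_norm[OF solves_on_diff[OF u v S(2)] S st] eq by simp

lemma solves_on_compact_interval:
  assumes s: "s \<in> {a..b}" and ab: "{a..b} \<subseteq> I" and x: "x \<in> D"
  shows "\<exists>u. u s = x \<and> solves_on {a..b} u"
proof -
  have le: "a \<le> b" using s by simp
  obtain C where C: "C \<ge> 0"
    "\<And>t r x. t \<in> {a..b} \<Longrightarrow> r \<in> {a..b} \<Longrightarrow> x \<in> D \<Longrightarrow>
      norm (A t x - A r x) \<le> C * \<bar>t - r\<bar> * (norm (A r x) + norm x)"
    using locally_lipschitz[OF le ab] by blast
  \<comment> \<open>Time is frozen outside \<open>{a..b}\<close>. The clamping map does not increase
    distances, so the family on the whole line keeps the constant \<open>C\<close>.\<close>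
  define p where "p t = max a (min b t)" for t
  have p: "p t \<in> {a..b}" for t using le by (auto simp: p_def)
  have p_id: "p t = t" if "t \<in> {a..b}" for t using that by (auto simp: p_def)
  have p_lip: "\<bar>p t - p r\<bar> \<le> \<bar>t - r\<bar>" for t r by (auto simp: p_def)
  interpret F: skew_adjoint_family D "\<lambda>t. A (p t)" C
  proof
    show "skew_adjoint D (A (p t))" for t using p ab skew by blast
    show "0 \<le> C" by (rule C(1))
    show "norm (A (p t) y - A (p r) y) \<le> C * \<bar>t - r\<bar> * (norm (A (p r) y) + norm y)"
      if "y \<in> D" for y t r
      using C(1) p_lip by (intro order_trans[OF C(2)[OF p p that]] mult_right_mono mult_left_mono) auto
  qed
  obtain u where u: "u s = x" "\<And>t. u t \<in> D" "\<And>t. (u has_vector_derivative A (p t) (u t)) (at t)"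
    using F.strong_solution_exists[OF x, of s] by blast
  have "(u has_vector_derivative A t (u t)) (at t within {a..b})" if "t \<in> {a..b}" for t
    using u(3)[of t] p_id[OF that] by (simp add: has_vector_derivative_at_within)
  with u show ?thesis unfolding solves_on_def by blast
qed

text \<open>Makes \<open>{a..b}\<close> a neighbourhood of \<open>t\<close> relative to
  \<open>I\<close>, so that derivatives at \<open>t\<close> within either set agree. When
  \<open>t\<close> is an endpoint of \<open>I\<close>, it serves as the endpoint of
  \<open>{a..b}\<close> on that side and any radius works there.\<close>

lemma compact_interval_neighbourhood:
  assumes s: "s \<in> I" and t: "t \<in> I"
  shows "\<exists>a b e. {a..b} \<subseteq> I \<and> s \<in> {a..b} \<and> t \<in> {a..b} \<and> 0 < e \<and> (\<forall>\<tau>\<in>I. \<bar>\<tau> - t\<bar> < e \<longrightarrow> \<tau> \<in> {a..b})"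
proof -
  have "\<exists>b\<in>I. s \<le> b \<and> t \<le> b \<and> (\<exists>e>0. \<forall>\<tau>\<in>I. \<tau> < t + e \<longrightarrow> \<tau> \<le> b)"
  proof (cases "\<exists>c\<in>I. t < c")
    case True
    then obtain c where c: "c \<in> I" "t < c" by blast
    show ?thesis
      by (rule bexI[of _ "max s c"]) (use c s in \<open>auto simp: max_def intro!: exI[of _ "c - t"]\<close>)
  next
    case False
    then have *: "\<And>\<tau>. \<tau> \<in> I \<Longrightarrow> \<tau> \<le> t" by force
    show ?thesis
      by (rule bexI[of _ t]) (use * s t in \<open>auto intro!: exI[of _ 1]\<close>)
  qed
  then obtain b e1 where b: "b \<in> I" "s \<le> b" "t \<le> b" "e1 > 0" "\<And>\<tau>. \<tau> \<in> I \<Longrightarrow> \<tau> < t + e1 \<Longrightarrow> \<tau> \<le> b"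
    by blast
  have "\<exists>a\<in>I. a \<le> s \<and> a \<le> t \<and> (\<exists>e>0. \<forall>\<tau>\<in>I. t - e < \<tau> \<longrightarrow> a \<le> \<tau>)"
  proof (cases "\<exists>c\<in>I. c < t")
    case True
    then obtain c where c: "c \<in> I" "c < t" by blast
    show ?thesis
      by (rule bexI[of _ "min s c"]) (use c s in \<open>auto simp: min_def intro!: exI[of _ "t - c"]\<close>)
  next
    case False
    then have *: "\<And>\<tau>. \<tau> \<in> I \<Longrightarrow> t \<le> \<tau>" by force
    show ?thesis
      by (rule bexI[of _ t]) (use * s t in \<open>auto intro!: exI[of _ 1]\<close>)
  qed
  then obtain a e2 where a: "a \<in> I" "a \<le> s" "a \<le> t" "e2 > 0" "\<And>\<tau>. \<tau> \<in> I \<Longrightarrow> t - e2 < \<tau> \<Longrightarrow> a \<le> \<tau>"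
    by blast
  have "{a..b} \<subseteq> I" using mem_is_interval_1_I[OF interval a(1) b(1)] by auto
  then show ?thesis using a b by (intro exI[of _ a] exI[of _ b] exI[of _ "min e1 e2"]) auto
qed

text \<open>For each \<open>t\<close> a solution on the segment between \<open>s\<close> and
  \<open>t\<close> is chosen and read off at \<open>t\<close>. Uniqueness makes these choices
  consistent.\<close>

lemma solves_on_exists:
  assumes s: "s \<in> I" and x: "x \<in> D"
  shows "\<exists>u. u s = x \<and> solves_on I u"
proof -
  have seg: "{min s t..max s t} \<subseteq> I" if "t \<in> I" for t
  proof -
    have "min s t \<in> I" "max s t \<in> I" using s that by (simp_all add: min_def max_def)
    from mem_is_interval_1_I[OF interval this] show ?thesis by auto
  qed
  have "\<exists>w. w s = x \<and> solves_on {min s t..max s t} w" if "t \<in> I" for t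
    by (rule solves_on_compact_interval) (use seg[OF that] x in auto)
  then obtain w where w: "\<And>t. t \<in> I \<Longrightarrow> w t s = x" "\<And>t. t \<in> I \<Longrightarrow> solves_on {min s t..max s t} (w t)"
    by metis
  define u where "u t = w t t" for t
  \<comment> \<open>Identifies \<open>u\<close> with any solution on a compact interval through
    \<open>s\<close>; near each \<open>t\<close> such a solution supplies the derivative.\<close>
  have u_eq: "u t = v t" if v: "v s = x" "solves_on {a..b} v" and ab: "{a..b} \<subseteq> I" and "s \<in> {a..b}" "t \<in> {a..b}"
    for v a b t
  proof -
    have t: "t \<in> I" using that by blast
    have "solves_on {min s t..max s t} v" using that by (intro solves_on_subset[OF v(2)]) auto
    from solves_on_unique[OF w(2)[OF t] this _ seg[OF t], of s t] show ?thesis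
      using w(1)[OF t] v(1) by (simp add: u_def)
  qed
  have "solves_on I u"
    unfolding solves_on_def
  proof (intro ballI)
    fix t assume t: "t \<in> I"
    obtain a b e where ab: "{a..b} \<subseteq> I" "s \<in> {a..b}" "t \<in> {a..b}"
      and e: "0 < e" "\<And>\<tau>. \<tau> \<in> I \<Longrightarrow> \<bar>\<tau> - t\<bar> < e \<Longrightarrow> \<tau> \<in> {a..b}"
      using compact_interval_neighbourhood[OF s t] by metis
    obtain v where v: "v s = x" "solves_on {a..b} v"
      using solves_on_compact_interval[OF ab(2,1) x] by blast
    have vt: "v t \<in> D" and dv: "(v has_vector_derivative A t (v t)) (at t within {a..b})"
      using v(2) ab(3) by (auto simp: solves_on_def)
    have "I \<inter> ball t e \<subseteq> {a..b}" using e(2) by (fastforce simp: dist_real_def)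
    with dv have "(v has_vector_derivative A t (v t)) (at t within I \<inter> ball t e)"
      by (rule has_vector_derivative_within_subset)
    moreover have "at t within I \<inter> ball t e = at t within I"
      by (rule at_within_nhd[where S = "ball t e"]) (use e in auto)
    ultimately have "(v has_vector_derivative A t (v t)) (at t within I)" by simp
    then have "(u has_vector_derivative A t (v t)) (at t within I)"
      using e(1) t
    proof (rule has_vector_derivative_transform_within)
      show "v \<tau> = u \<tau>" if "\<tau> \<in> I" "dist \<tau> t < e" for \<tau>
        using u_eq[OF v ab(1,2) e(2)] that by (simp add: dist_real_def)
    qed
    then show "u t \<in> D \<and> (u has_vector_derivative A t (u t)) (at t within I)"
      using u_eq[OF v ab] vt by simp
  qed
  moreover have "u s = x" unfolding u_def by (rule w(1)[OF s])
  ultimately show ?thesis by blast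
qed

section \<open>Solution operators on the domain\<close>

definition flow :: "real \<Rightarrow> real \<Rightarrow> 'a \<Rightarrow> 'a" where
  "flow t s x = (SOME u. u s = x \<and> solves_on I u) t"

lemma convex_I: "convex I"
  using interval by (simp add: is_interval_convex_1)

lemma flow_solves:
  assumes "s \<in> I" "x \<in> D"
  shows flow_same: "flow s s x = x" and flow_solves_on: "solves_on I (\<lambda>t. flow t s x)"
  using someI_ex[OF solves_on_exists[OF assms]] unfolding flow_def by auto

lemma flow_in_D: "s \<in> I \<Longrightarrow> t \<in> I \<Longrightarrow> x \<in> D \<Longrightarrow> flow t s x \<in> D"
  using flow_solves_on unfolding solves_on_def by blast

text \<open>The source of the algebraic laws: a law holds as soon as its other side, as a function
  of time, is recognised as a solution.\<close>

lemma flow_unique: "solves_on I u \<Longrightarrow> s \<in> I \<Longrightarrow> t \<in> I \<Longrightarrow> u t = flow t s (u s)"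
  by (rule solves_on_unique[OF _ flow_solves_on convex_I order_refl, of u s "u s" s])
     (simp_all add: flow_same solves_on_def)

lemma flow_flow:
  assumes "r \<in> I" "s \<in> I" "t \<in> I" "x \<in> D"
  shows "flow r s (flow s t x) = flow r t x"
  using flow_unique[OF flow_solves_on[OF assms(3,4)] assms(2,1)] by simp

lemma flow_diff:
  assumes st: "s \<in> I" "t \<in> I" and D: "x \<in> D" "y \<in> D"
  shows "flow t s (x - y) = flow t s x - flow t s y"
  using flow_unique[OF solves_on_diff[OF flow_solves_on[OF st(1) D(1)] flow_solves_on[OF st(1) D(2)] order_refl] st]
  by (simp add: flow_same st D)

lemma flow_isometry:
  assumes st: "s \<in> I" "t \<in> I" and D: "x \<in> D" "y \<in> D"
  shows "dist (flow t s x) (flow t s y) = dist x y"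
  using solves_on_norm[OF solves_on_diff[OF flow_solves_on[OF st(1) D(1)] flow_solves_on[OF st(1) D(2)] order_refl]
      convex_I order_refl st]
  by (simp add: flow_same st D dist_norm)

text \<open>\<open>T\<close> maps solutions to solutions. For the extended propagator, the instances
  are multiplication by a real scalar and the complex structure.\<close>

lemma flow_commute:
  assumes T: "bounded_linear T" and TD: "\<And>x. x \<in> D \<Longrightarrow> T x \<in> D"
    and TA: "\<And>t x. t \<in> I \<Longrightarrow> x \<in> D \<Longrightarrow> A t (T x) = T (A t x)"
    and st: "s \<in> I" "t \<in> I" and x: "x \<in> D"
  shows "flow t s (T x) = T (flow t s x)"
proof -
  have "solves_on I (\<lambda>t. T (flow t s x))"
    unfolding solves_on_def
  proof (intro ballI conjI)
    fix t assume t: "t \<in> I"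
    have D: "flow t s x \<in> D" and d: "((\<lambda>t. flow t s x) has_vector_derivative A t (flow t s x)) (at t within I)"
      using flow_solves_on[OF st(1) x] t by (auto simp: solves_on_def)
    show "T (flow t s x) \<in> D" by (rule TD[OF D])
    show "((\<lambda>t. T (flow t s x)) has_vector_derivative A t (T (flow t s x))) (at t within I)"
      unfolding TA[OF t D] by (rule bounded_linear.has_vector_derivative[OF T d])
  qed
  from flow_unique[OF this st] show ?thesis by (simp add: flow_same st x)
qed

section \<open>Extension to the whole space, unitarity and strong continuity\<close>

definition propagator :: "real \<Rightarrow> real \<Rightarrow> 'a \<Rightarrow> 'a" where
  "propagator t s = (SOME g. (\<forall>x\<in>D. g x = flow t s x) \<and> (\<forall>x y. dist (g x) (g y) = dist x y))"

lemma dense: "t \<in> I \<Longrightarrow> closure D = UNIV"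
  by (rule skew_adjoint_dense[OF skew])

lemma
  assumes st: "s \<in> I" "t \<in> I"
  shows propagator_eq_flow: "x \<in> D \<Longrightarrow> propagator t s x = flow t s x"
    and propagator_isometry: "dist (propagator t s x) (propagator t s y) = dist x y"
  using someI_ex[OF dense_isometry_extension[OF dense[OF st(1)] flow_isometry[OF st]]]
  unfolding propagator_def[symmetric] by blast+

lemma propagator_continuous: "s \<in> I \<Longrightarrow> t \<in> I \<Longrightarrow> continuous_on S (propagator t s)"
  by (rule isometry_continuous) (rule propagator_isometry)

lemma propagator_compose_continuous:
  "s \<in> I \<Longrightarrow> t \<in> I \<Longrightarrow> continuous_on S h \<Longrightarrow> continuous_on S (\<lambda>x. propagator t s (h x))"
  using continuous_on_compose2[OF propagator_continuous[of s t UNIV]] by blast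

lemma propagator_propagator:
  assumes "r \<in> I" "s \<in> I" "t \<in> I"
  shows "propagator r s (propagator s t x) = propagator r t x"
  by (rule dense_eqI[OF dense[OF assms(1)], where f = "\<lambda>x. propagator r s (propagator s t x)"])
     (use assms in \<open>auto intro!: propagator_compose_continuous propagator_continuous
        simp: propagator_eq_flow flow_in_D flow_flow\<close>)

lemma propagator_same:
  assumes "t \<in> I"
  shows "propagator t t x = x"
  by (rule dense_eqI[OF dense[OF assms], where g = "\<lambda>x. x"])
     (use assms in \<open>auto intro!: propagator_continuous simp: propagator_eq_flow flow_same\<close>)

lemma propagator_commute:
  assumes T: "bounded_linear T" and TD: "\<And>x. x \<in> D \<Longrightarrow> T x \<in> D"
    and TA: "\<And>t x. t \<in> I \<Longrightarrow> x \<in> D \<Longrightarrow> A t (T x) = T (A t x)"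
    and st: "s \<in> I" "t \<in> I"
  shows "propagator t s (T x) = T (propagator t s x)"
proof (rule dense_eqI[OF dense[OF st(1)], where f = "\<lambda>x. propagator t s (T x)"])
  have T': "continuous_on UNIV T" using T by (rule linear_continuous_on)
  then show "continuous_on UNIV (\<lambda>x. propagator t s (T x))" by (rule propagator_compose_continuous[OF st])
  show "continuous_on UNIV (\<lambda>x. T (propagator t s x))"
    by (rule continuous_on_compose2[OF T' propagator_continuous[OF st]]) simp
  show "propagator t s (T x) = T (propagator t s x)" if "x \<in> D" for x
    using that TD flow_commute[OF T TD TA st] by (simp add: propagator_eq_flow[OF st])
qed

lemma propagator_scale:
  assumes st: "s \<in> I" "t \<in> I"
  shows "propagator t s (c *\<^sub>R x) = c *\<^sub>R propagator t s x"
  by (rule propagator_commute[OF bounded_linear_scaleR_right _ _ st])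
     (use st in \<open>auto intro: subspace_scale[OF skew_adjoint_subspace[OF skew[OF st(1)]]]
        skew_adjoint_scale[OF skew]\<close>)

lemma propagator_diff:
  assumes st: "s \<in> I" "t \<in> I"
  shows "propagator t s (x - y) = propagator t s x - propagator t s y"
proof -
  note cont = propagator_compose_continuous[OF st] propagator_continuous[OF st]
  have D: "x - y \<in> D" if "x \<in> D" "y \<in> D" for x y
    using subspace_diff[OF skew_adjoint_subspace[OF skew[OF st(1)]]] that by blast
  have 1: "propagator t s (x - y) = propagator t s x - propagator t s y" if "y \<in> D" for x y
    by (rule dense_eqI[OF dense[OF st(1)], where f = "\<lambda>x. propagator t s (x - y)"])
       (use that in \<open>auto intro!: continuous_intros cont simp: propagator_eq_flow[OF st] D flow_diff[OF st]\<close>)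
  show ?thesis
    by (rule dense_eqI[OF dense[OF st(1)], where f = "\<lambda>y. propagator t s (x - y)"])
       (use 1 in \<open>auto intro!: continuous_intros cont\<close>)
qed

lemma propagator_add:
  assumes st: "s \<in> I" "t \<in> I"
  shows "propagator t s (x + y) = propagator t s x + propagator t s y"
  using propagator_diff[OF st, of x "(-1) *\<^sub>R y"] propagator_scale[OF st, of "-1" y] by simp

lemma propagator_norm: "s \<in> I \<Longrightarrow> t \<in> I \<Longrightarrow> norm (propagator t s x) = norm x"
  using propagator_isometry[of s t x 0] propagator_scale[of s t 0 0] by (simp add: dist_norm)

lemma propagator_inner:
  assumes st: "s \<in> I" "t \<in> I"
  shows "propagator t s x \<bullet> propagator t s y = x \<bullet> y"
  unfolding dot_norm propagator_add[OF st, symmetric] propagator_norm[OF st] ..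

lemma propagator_deriv:
  assumes "s \<in> I" "t \<in> I" "x \<in> D"
  shows propagator_in_D: "propagator t s x \<in> D"
    and propagator_has_vector_derivative:
      "((\<lambda>\<tau>. propagator \<tau> s x) has_vector_derivative A t (propagator t s x)) (at t within I)"
proof -
  have d: "((\<lambda>\<tau>. flow \<tau> s x) has_vector_derivative A t (flow t s x)) (at t within I)"
    using flow_solves_on[of s x] assms unfolding solves_on_def by blast
  show "propagator t s x \<in> D" using assms by (simp add: propagator_eq_flow flow_in_D)
  show "((\<lambda>\<tau>. propagator \<tau> s x) has_vector_derivative A t (propagator t s x)) (at t within I)"
    unfolding propagator_eq_flow[OF assms]
    by (rule has_vector_derivative_transform[OF assms(2) _ d]) (simp add: propagator_eq_flow assms)
qed

text \<open>Orbits of vectors in \<open>D\<close> are differentiable, hence continuous. Isometry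
  makes the approximation of \<open>x\<close> by such vectors uniform in time.\<close>

lemma propagator_continuous_in_time:
  assumes s: "s \<in> I"
  shows "continuous_on I (\<lambda>t. propagator t s x)"
  unfolding continuous_on_iff
proof (intro ballI allI impI)
  fix t and e :: real assume t: "t \<in> I" and e: "0 < e"
  have e3: "0 < e / 3" using e by simp
  have "x \<in> closure D" using dense[OF s] by simp
  then obtain y where y: "y \<in> D" and yx: "dist y x < e / 3"
    using e3 unfolding closure_approachable by blast
  have "continuous_on I (\<lambda>t. propagator t s y)"
    unfolding continuous_on_eq_continuous_within
    using propagator_has_vector_derivative[OF s _ y] has_vector_derivative_continuous by blast
  then obtain d where d: "d > 0"
    "\<And>\<tau>. \<tau> \<in> I \<Longrightarrow> dist \<tau> t < d \<Longrightarrow> dist (propagator \<tau> s y) (propagator t s y) < e / 3"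
    using t e3 unfolding continuous_on_iff by blast
  have "dist (propagator \<tau> s x) (propagator t s x) < e" if \<tau>: "\<tau> \<in> I" "dist \<tau> t < d" for \<tau>
  proof -
    have "dist (propagator \<tau> s x) (propagator t s x)
        \<le> dist (propagator \<tau> s x) (propagator \<tau> s y) + dist (propagator \<tau> s y) (propagator t s y)
          + dist (propagator t s y) (propagator t s x)"
      using dist_triangle[of "propagator \<tau> s x" "propagator t s x" "propagator \<tau> s y"]
        dist_triangle[of "propagator \<tau> s y" "propagator t s x" "propagator t s y"] by linarith
    also have "\<dots> < e"
      using d(2)[OF \<tau>] yx by (simp add: propagator_isometry s t \<tau> dist_commute)
    finally show ?thesis .
  qed
  with d(1) show "\<exists>d>0. \<forall>\<tau>\<in>I. dist \<tau> t < d \<longrightarrow> dist (propagator \<tau> s x) (propagator t s x) < e"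
    by blast
qed

lemma propagator_jointly_continuous: "continuous_on (I \<times> I) (\<lambda>(t, s). propagator t s x)"
  unfolding continuous_on_iff
proof (intro ballI allI impI)
  fix p :: "real \<times> real" and e :: real assume "p \<in> I \<times> I" and e: "0 < e"
  then obtain t s where t: "t \<in> I" and s: "s \<in> I" and p: "p = (t, s)" by blast
  have e2: "0 < e / 2" using e by simp
  have cont: "\<exists>d>0. \<forall>\<tau>\<in>I. dist \<tau> t < d \<longrightarrow> dist (propagator \<tau> s x) (propagator t s x) < e / 2"
    if "t \<in> I" for t
    using propagator_continuous_in_time[OF s, of x] that e2 unfolding continuous_on_iff by blast
  obtain d1 where d1: "d1 > 0" "\<And>\<tau>. \<tau> \<in> I \<Longrightarrow> dist \<tau> t < d1 \<Longrightarrow> dist (propagator \<tau> s x) (propagator t s x) < e / 2"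
    using cont[OF t] by blast
  obtain d2 where d2: "d2 > 0" "\<And>\<tau>. \<tau> \<in> I \<Longrightarrow> dist \<tau> s < d2 \<Longrightarrow> dist (propagator \<tau> s x) (propagator s s x) < e / 2"
    using cont[OF s] by blast
  have "dist (propagator t' s' x) (propagator t s x) < e"
    if t': "t' \<in> I" and s': "s' \<in> I" and near: "dist (t', s') (t, s) < min d1 d2" for t' s'
  proof -
    have "dist t' t < d1" "dist s' s < d2"
      using near dist_fst_le[of "(t', s')" "(t, s)"] dist_snd_le[of "(t', s')" "(t, s)"] by auto
    have "dist (propagator t' s' x) (propagator t' s x)
        = dist (propagator t' s' x) (propagator t' s' (propagator s' s x))"
      by (simp add: propagator_propagator t' s' s)
    also have "\<dots> = dist (propagator s' s x) (propagator s s x)"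
      by (simp add: propagator_isometry t' s' s propagator_same dist_commute)
    also have "\<dots> < e / 2" by (rule d2(2)[OF s' \<open>dist s' s < d2\<close>])
    finally show ?thesis
      using d1(2)[OF t' \<open>dist t' t < d1\<close>]
        dist_triangle[of "propagator t' s' x" "propagator t s x" "propagator t' s x"] by linarith
  qed
  then show "\<exists>d>0. \<forall>p'\<in>I \<times> I. dist p' p < d \<longrightarrow>
      dist (case p' of (t, s) \<Rightarrow> propagator t s x) (case p of (t, s) \<Rightarrow> propagator t s x) < e"
    using d1(1) d2(1) unfolding p by (intro exI[of _ "min d1 d2"]) auto
qed

text \<open>A real isometry that commutes with \<open>J\<close> is complex linear and preserves both
  components of the complex inner product; the cocycle law supplies the inverse.\<close>

lemma propagator_unitary:
  assumes J: "complex_structure J" and JD: "\<And>x. x \<in> D \<Longrightarrow> J x \<in> D"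
    and JA: "\<And>t x. t \<in> I \<Longrightarrow> x \<in> D \<Longrightarrow> A t (J x) = J (A t x)"
  shows "unitary_propagator J I propagator"
proof -
  have "linear J" and normJ: "\<And>x. norm (J x) = norm x"
    using J by (auto simp: complex_structure_def)
  then have J': "bounded_linear J"
    by (intro bounded_linear_intro[where K = 1]) (auto simp: linear_add linear_scale)
  have comm: "propagator t s (J x) = J (propagator t s x)" if "s \<in> I" "t \<in> I" for s t x
    by (rule propagator_commute[OF J' JD JA that])
  have "unitary_op J (propagator t s)" if st: "s \<in> I" "t \<in> I" for s t
    unfolding unitary_op_def clinear_on_def cinner_def
  proof (intro conjI ballI allI)
    show "surj (propagator t s)"
      using propagator_propagator[OF st(2,1) st(2)] propagator_same[OF st(2)] by (metis surjI)
    show "propagator t s (cscale J c x) = cscale J c (propagator t s x)" for c x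
      by (simp add: cscale_def propagator_add st propagator_scale comm)
    show "Complex (propagator t s x \<bullet> propagator t s y) (propagator t s x \<bullet> J (propagator t s y))
        = Complex (x \<bullet> y) (x \<bullet> J y)" for x y
      by (simp add: propagator_inner st flip: comm[OF st])
  qed (simp add: propagator_add st)
  then show ?thesis
    unfolding unitary_propagator_def
    using propagator_propagator propagator_same propagator_jointly_continuous by blast
qed

end

section \<open>From self-adjoint Hamiltonians to skew-adjoint evolution\<close>

lemma self_adjoint_imp_skew_adjoint:
  fixes J :: "'a::{real_inner, complete_space} \<Rightarrow> 'a"
  assumes J: "complex_structure J" and H: "self_adjoint_op J D H"
  shows "skew_adjoint D (\<lambda>x. - J (H x))"
    and "x \<in> D \<Longrightarrow> J x \<in> D" and "x \<in> D \<Longrightarrow> H (J x) = J (H x)"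
proof -
  have linJ: "linear J" and JJ: "\<And>x. J (J x) = - x" and normJ: "\<And>x. norm (J x) = norm x"
    using J by (auto simp: complex_structure_def)
  have JinnerJ: "J x \<bullet> J y = x \<bullet> y" for x y
    unfolding dot_norm linear_add[OF linJ, symmetric] normJ ..
  have Jinner: "J x \<bullet> y = - (x \<bullet> J y)" for x y
    using JinnerJ[of x "J y"] by (simp add: JJ)
  have D: "subspace D" "closure D = UNIV" and JD: "\<And>x. x \<in> D \<Longrightarrow> J x \<in> D"
    and add: "\<And>x y. x \<in> D \<Longrightarrow> y \<in> D \<Longrightarrow> H (x + y) = H x + H y"
    and cscale: "\<And>c x. x \<in> D \<Longrightarrow> H (cscale J c x) = cscale J c (H x)"
    and sym: "\<And>x y. x \<in> D \<Longrightarrow> y \<in> D \<Longrightarrow> cinner J (H x) y = cinner J x (H y)"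
    and dom: "adjoint_dom J D H = D"
    using H by (auto simp: self_adjoint_op_def symmetric_op_def densely_defined_def csubspace_def clinear_on_def)
  have scale: "H (c *\<^sub>R x) = c *\<^sub>R H x" if "x \<in> D" for c x
    using cscale[OF that, of "of_real c"] by (simp add: cscale_def)
  have HJ: "H (J x) = J (H x)" if "x \<in> D" for x
    using cscale[OF that, of \<i>] by (simp add: cscale_def)
  show "x \<in> D \<Longrightarrow> J x \<in> D" "x \<in> D \<Longrightarrow> H (J x) = J (H x)" by (fact JD, fact HJ)
  show "skew_adjoint D (\<lambda>x. - J (H x))"
    unfolding skew_adjoint_def
  proof (intro conjI ballI allI impI)
    show "- J (H x) \<bullet> y = - (x \<bullet> - J (H y))" if "x \<in> D" "y \<in> D" for x y
      using sym[OF that] by (simp add: cinner_def Jinner)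
    fix y z assume *: "\<forall>x\<in>D. - J (H x) \<bullet> y = x \<bullet> z"
    \<comment> \<open>The real identity is used twice: at \<open>x\<close> it gives the imaginary
      part, at \<open>J x\<close> the real part. The adjoint vector is \<open>- J z\<close>, because
      the generator carries the factor \<open>- J\<close>.\<close>
    have "cinner J (H x) y = cinner J x (- J z)" if "x \<in> D" for x
    proof -
      have "H x \<bullet> J y = x \<bullet> z" using *[rule_format, OF that] by (simp add: Jinner)
      moreover have "H x \<bullet> y = - (x \<bullet> J z)"
        using *[rule_format, OF JD[OF that]] by (simp add: HJ[OF that] JJ Jinner)
      ultimately show ?thesis by (simp add: cinner_def linear_neg[OF linJ] JJ)
    qed
    then have "y \<in> adjoint_dom J D H" unfolding adjoint_dom_def by blast
    then show "y \<in> D" by (simp add: dom)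
  qed (simp_all add: D add scale linear_add[OF linJ] linear_scale[OF linJ])
qed

lemma lipschitz_on_compact_if_C1:
  fixes f f' :: "real \<Rightarrow> real"
  assumes "\<forall>t\<in>I. (f has_real_derivative f' t) (at t within I)" "continuous_on I f'" "{a..b} \<subseteq> I"
  shows "\<exists>M\<ge>0. \<forall>t\<in>{a..b}. \<forall>r\<in>{a..b}. \<bar>f t - f r\<bar> \<le> M * \<bar>t - r\<bar>"
proof -
  have "compact (f' ` {a..b})"
    using assms(2,3) by (intro compact_continuous_image) (auto intro: continuous_on_subset)
  then obtain M where M: "M > 0" "\<And>t. t \<in> {a..b} \<Longrightarrow> norm (f' t) \<le> M"
    using compact_imp_bounded bounded_pos by (metis imageI)
  have "norm (f t - f r) \<le> M * norm (t - r)" if "t \<in> {a..b}" "r \<in> {a..b}" for t r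
  proof (rule field_differentiable_bound[OF convex_real_interval(5) _ M(2) that])
    show "(f has_real_derivative f' z) (at z within {a..b})" if "z \<in> {a..b}" for z
      using assms(1,3) that by (blast intro: DERIV_subset)
  qed
  with M(1) show ?thesis by (intro exI[of _ M]) auto
qed

theorem theorem1:
  fixes J :: "'a::{real_inner, complete_space} \<Rightarrow> 'a"
    and D :: "'a set"
    and n :: nat
    and Hs :: "nat \<Rightarrow> 'a \<Rightarrow> 'a"
    and f :: "nat \<Rightarrow> real \<Rightarrow> real"
    and I :: "real set"
  assumes J: "complex_structure J"
    and sym: "\<forall>i<n. symmetric_op J D (Hs i)"
    and I: "is_interval I"
    and sa: "\<forall>t\<in>I. self_adjoint_op J D (\<lambda>x. \<Sum>i<n. f i t *\<^sub>R Hs i x)"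
    and C1: "\<forall>i<n. \<exists>f'. (\<forall>t\<in>I. (f i has_real_derivative f' t) (at t within I))
                        \<and> continuous_on I f'"
    and bnd: "\<forall>i<n. \<exists>K>0. \<forall>t\<in>I. \<forall>x\<in>D.
                 norm (Hs i x) \<le> K * (norm (\<Sum>j<n. f j t *\<^sub>R Hs j x) + norm x)"
  shows "\<exists>U. unitary_propagator J I U
           \<and> (\<forall>s\<in>I. \<forall>x\<in>D. \<forall>t\<in>I. U t s x \<in> D
                \<and> ((\<lambda>\<tau>. U \<tau> s x) has_vector_derivative
                     cscale J (- \<i>) (\<Sum>i<n. f i t *\<^sub>R Hs i (U t s x))) (at t within I))"
proof -
  define H where "H t x = (\<Sum>i<n. f i t *\<^sub>R Hs i x)" for t x
  have linJ: "linear J" and normJ: "\<And>x. norm (J x) = norm x"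
    using J by (auto simp: complex_structure_def)
  have saH: "self_adjoint_op J D (H t)" if "t \<in> I" for t
    using sa that unfolding H_def by blast
  note sk = self_adjoint_imp_skew_adjoint[OF J saH]
  obtain K where K: "\<And>i. i < n \<Longrightarrow> K i > 0"
    "\<And>i t x. i < n \<Longrightarrow> t \<in> I \<Longrightarrow> x \<in> D \<Longrightarrow> norm (Hs i x) \<le> K i * (norm (H t x) + norm x)"
    using bnd unfolding H_def by metis
  interpret E: skew_adjoint_evolution D "\<lambda>t x. - J (H t x)" I
  proof
    show "is_interval I" by (rule I)
    show "skew_adjoint D (\<lambda>x. - J (H t x))" if "t \<in> I" for t by (rule sk(1)[OF that])
    fix a b assume ab: "{a..b} \<subseteq> I"
    have "\<exists>M\<ge>0. \<forall>t\<in>{a..b}. \<forall>r\<in>{a..b}. \<bar>f i t - f i r\<bar> \<le> M * \<bar>t - r\<bar>" if "i < n" for i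
      using C1 that lipschitz_on_compact_if_C1[OF _ _ ab] by blast
    then obtain M where M: "\<And>i. i < n \<Longrightarrow> M i \<ge> 0"
      "\<And>i t r. i < n \<Longrightarrow> t \<in> {a..b} \<Longrightarrow> r \<in> {a..b} \<Longrightarrow> \<bar>f i t - f i r\<bar> \<le> M i * \<bar>t - r\<bar>"
      by metis
    have "norm (- J (H t x) - - J (H r x))
        \<le> (\<Sum>i<n. M i * K i) * \<bar>t - r\<bar> * (norm (- J (H r x)) + norm x)"
      if t: "t \<in> {a..b}" and r: "r \<in> {a..b}" and x: "x \<in> D" for t r x
    proof -
      have "- J (H t x) - - J (H r x) = J (H r x - H t x)" by (simp add: linear_diff[OF linJ])
      then have "norm (- J (H t x) - - J (H r x)) = norm (H t x - H r x)"
        by (simp add: normJ norm_minus_commute)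
      also have "H t x - H r x = (\<Sum>i<n. (f i t - f i r) *\<^sub>R Hs i x)"
        by (simp add: H_def sum_subtractf scaleR_diff_left)
      \<comment> \<open>Each term pairs the Lipschitz constant of a coefficient with the relative
        bound of its operator at time \<open>r\<close>, whence the constant
        \<open>\<Sum>i<n. M i * K i\<close>.\<close>
      also have "norm \<dots> \<le> (\<Sum>i<n. (M i * \<bar>t - r\<bar>) * (K i * (norm (H r x) + norm x)))"
        using M K(2)[OF _ _ x] K(1) t r ab
        by (intro sum_norm_le) (auto intro!: mult_mono)
      also have "\<dots> = (\<Sum>i<n. M i * K i) * \<bar>t - r\<bar> * (norm (- J (H r x)) + norm x)"
        by (simp add: normJ sum_distrib_left sum_distrib_right mult_ac)
      finally show ?thesis .
    qed
    moreover have "0 \<le> (\<Sum>i<n. M i * K i)"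
      using M(1) K(1) by (intro sum_nonneg mult_nonneg_nonneg) (auto intro: less_imp_le)
    ultimately show "\<exists>C\<ge>0. \<forall>t\<in>{a..b}. \<forall>r\<in>{a..b}. \<forall>x\<in>D.
        norm (- J (H t x) - - J (H r x)) \<le> C * \<bar>t - r\<bar> * (norm (- J (H r x)) + norm x)"
      by blast
  qed
  have "unitary_propagator J I E.propagator"
  \<comment> \<open>Invariance of \<open>D\<close> under \<open>J\<close> is drawn from
    self-adjointness at some time, so \<open>I\<close> has to be nonempty here; on the empty
    interval the claim is vacuous.\<close>
  proof (cases "I = {}")
    case False
    then show ?thesis
      using sk(2,3) by (intro E.propagator_unitary J) (auto simp: linear_neg[OF linJ])
  qed (simp add: unitary_propagator_def)
  moreover have "E.propagator t s x \<in> D \<and> ((\<lambda>\<tau>. E.propagator \<tau> s x) has_vector_derivative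
      cscale J (- \<i>) (\<Sum>i<n. f i t *\<^sub>R Hs i (E.propagator t s x))) (at t within I)"
    if "s \<in> I" "x \<in> D" "t \<in> I" for s x t
    using E.propagator_deriv[OF that(1,3,2)] by (simp add: cscale_def H_def)
  ultimately show ?thesis by blast
qed

end
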